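(* Let $n\in\omega$ and let $P,Q\leq \mathrm{Sym}(\mathbb{N})$ be Polish permutation groups. If the algebraic dimension of $Q$ is at most $n$, and $P$ is locally finite and $(n+1)$-free, then $E(P)$ is generically $E_{\mathrm{inj}}(Q)$-ergodic. In particular, $E(P)\not\leq_B E_{\mathrm{inj}}(Q)$.
   Context: A Polish permutation group is a closed subgroup of $\mathrm{Sym}(\mathbb{N})$ (pointwise convergence topology). For $P\leq\mathrm{Sym}(\mathbb{N})$ and $A\subseteq\mathbb{N}$, $P_A$ denotes the pointwise stabilizer of $A$, and $[A]_P:=\{a\in\mathbb{N}: \text{the orbit } P_A\cdot a \text{ is finite}\}$. The algebraic dimension of $P$ is the smallest $n\in\omega\cup\{\infty\}$ such that for every $A\subseteq\mathbb{N}$ with $|A|=n+1$ there is $a\in A$ with $a\in[A\setminus\{a\}]_P$. $P$ is locally finite if $[A]_P$ is finite for every finite $A\subseteq\mathbb{N}$. $P$ is $n$-free if for every finite $A\subseteq\mathbb{N}$ there are $g_0,\dots,g_{n-1}\in P$ such that for every $i<n$, the sets $[g_i\cdot A]_P$ and $[\bigcup_{j\neq i} g_j\cdot A]_P$ are disjoint. The Bernoulli shift of $P$ is the action of $P$ on $\mathbb{R}^{\mathbb{N}}$ given by $(gx)(a)=x(g^{-1}(a))$; $E(P)$ is its orbit equivalence relation, and $E_{\mathrm{inj}}(P)$ is the restriction of $E(P)$ to the invariant set $\mathrm{Inj}(\mathbb{N},\mathbb{R})$ of injective sequences. For analytic equivalence relations $E$ on $X$ and $F$ on $Y$ (Polish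 spaces), $E$ is generically $F$-ergodic if every Baire-measurable map $f:X\to Y$ with $x\,E\,x'\Rightarrow f(x)\,F\,f(x')$ maps a comeager subset of $X$ into a single $F$-class. $E\leq_B F$ means there is a Borel $f:X\to Y$ with $x\,E\,x'\iff f(x)\,F\,f(x')$. *)

theory Defs
  imports "HOL-Analysis.Analysis" "HOL-Probability.Probability"
begin

text \<open>Sym(N) = bijections of nat; the pointwise convergence topology is the product
topology on nat \<Rightarrow> nat (nat carries the discrete topology), restricted to Sym(N).
A Polish permutation group is a closed subgroup of Sym(N).\<close>

definition polish_perm_group :: "(nat \<Rightarrow> nat) set \<Rightarrow> bool" where
  "polish_perm_group P \<longleftrightarrow>
     P \<subseteq> {g. bij g} \<and> id \<in> P \<and>
     (\<forall>g\<in>P. \<forall>h\<in>P. g \<circ> h \<in> P) \<and> (\<forall>g\<in>P. inv g \<in> P) \<and>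
     closedin (top_of_set {g :: nat \<Rightarrow> nat. bij g}) P"

definition pstab :: "(nat \<Rightarrow> nat) set \<Rightarrow> nat set \<Rightarrow> (nat \<Rightarrow> nat) set" where
  "pstab P A = {g \<in> P. \<forall>a\<in>A. g a = a}"

definition acl :: "(nat \<Rightarrow> nat) set \<Rightarrow> nat set \<Rightarrow> nat set" where
  "acl P A = {a. finite ((\<lambda>g. g a) ` pstab P A)}"

definition alg_dim_prop :: "(nat \<Rightarrow> nat) set \<Rightarrow> nat \<Rightarrow> bool" where
  "alg_dim_prop P n \<longleftrightarrow>
     (\<forall>A. card A = Suc n \<longrightarrow> (\<exists>a\<in>A. a \<in> acl P (A - {a})))"

definition alg_dim :: "(nat \<Rightarrow> nat) set \<Rightarrow> enat" where
  "alg_dim P = (if \<exists>n. alg_dim_prop P n then enat (LEAST n. alg_dim_prop P n) else \<infinity>)"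

definition locally_finite_pg :: "(nat \<Rightarrow> nat) set \<Rightarrow> bool" where
  "locally_finite_pg P \<longleftrightarrow> (\<forall>A. finite A \<longrightarrow> finite (acl P A))"

definition n_free :: "nat \<Rightarrow> (nat \<Rightarrow> nat) set \<Rightarrow> bool" where
  "n_free n P \<longleftrightarrow>
     (\<forall>A. finite A \<longrightarrow>
        (\<exists>g :: nat \<Rightarrow> nat \<Rightarrow> nat. (\<forall>i<n. g i \<in> P) \<and>
           (\<forall>i<n. acl P (g i ` A) \<inter> acl P (\<Union>j\<in>{j. j < n \<and> j \<noteq> i}. g j ` A) = {})))"

definition bshift :: "(nat \<Rightarrow> nat) \<Rightarrow> (nat \<Rightarrow> real) \<Rightarrow> (nat \<Rightarrow> real)" where
  "bshift g x = (\<lambda>a. x (inv g a))"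

definition bernoulli_eq :: "(nat \<Rightarrow> nat) set \<Rightarrow> ((nat \<Rightarrow> real) \<times> (nat \<Rightarrow> real)) set" where
  "bernoulli_eq P = {(x, y). \<exists>g\<in>P. y = bshift g x}"

definition inj_seqs :: "(nat \<Rightarrow> real) set" where
  "inj_seqs = {x. inj x}"

definition bernoulli_eq_inj :: "(nat \<Rightarrow> nat) set \<Rightarrow> ((nat \<Rightarrow> real) \<times> (nat \<Rightarrow> real)) set" where
  "bernoulli_eq_inj P = bernoulli_eq P \<inter> (inj_seqs \<times> inj_seqs)"

definition nowhere_dense_in :: "'a topology \<Rightarrow> 'a set \<Rightarrow> bool" where
  "nowhere_dense_in X S \<longleftrightarrow> S \<subseteq> topspace X \<and> X interior_of (X closure_of S) = {}"

definition meager_in :: "'a topology \<Rightarrow> 'a set \<Rightarrow> bool" where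
  "meager_in X S \<longleftrightarrow> (\<exists>F. countable F \<and> (\<forall>T\<in>F. nowhere_dense_in X T) \<and> S \<subseteq> \<Union>F)"

definition comeager_in :: "'a topology \<Rightarrow> 'a set \<Rightarrow> bool" where
  "comeager_in X S \<longleftrightarrow> S \<subseteq> topspace X \<and> meager_in X (topspace X - S)"

definition baire_property_in :: "'a topology \<Rightarrow> 'a set \<Rightarrow> bool" where
  "baire_property_in X S \<longleftrightarrow> (\<exists>U. openin X U \<and> meager_in X ((S - U) \<union> (U - S)))"

definition baire_measurable :: "'a topology \<Rightarrow> 'b topology \<Rightarrow> ('a \<Rightarrow> 'b) \<Rightarrow> bool" where
  "baire_measurable X Y f \<longleftrightarrow>
     f \<in> topspace X \<rightarrow> topspace Y \<and>
     (\<forall>U. openin Y U \<longrightarrow> baire_property_in X {x \<in> topspace X. f x \<in> U})"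

definition generically_ergodic ::
  "'a topology \<Rightarrow> ('a \<times> 'a) set \<Rightarrow> 'b topology \<Rightarrow> ('b \<times> 'b) set \<Rightarrow> bool" where
  "generically_ergodic X E Y F \<longleftrightarrow>
     (\<forall>f. baire_measurable X Y f \<and>
          (\<forall>x\<in>topspace X. \<forall>x'\<in>topspace X. (x, x') \<in> E \<longrightarrow> (f x, f x') \<in> F) \<longrightarrow>
          (\<exists>C. comeager_in X C \<and> (\<exists>y\<in>topspace Y. \<forall>x\<in>C. (f x, y) \<in> F)))"

text \<open>Borel reducibility of E (on the whole space 'a) to F (on the subspace Y of 'b).
A map into the subspace Y is Borel iff it is Borel as a map into 'b with values in Y.\<close>
definition borel_reducible ::
  "('a::topological_space \<times> 'a) set \<Rightarrow> ('b::topological_space) set \<Rightarrow> ('b \<times> 'b) set \<Rightarrow> bool" where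
  "borel_reducible E Y F \<longleftrightarrow>
     (\<exists>f. f \<in> borel_measurable borel \<and> (\<forall>x. f x \<in> Y) \<and>
          (\<forall>x x'. (x, x') \<in> E \<longleftrightarrow> (f x, f x') \<in> F))"

end

theory Submission
  imports Defs
begin

text \<open>
  Let \<^term>\<open>f\<close> be a Baire-measurable homomorphism. On a comeager set \<^term>\<open>C\<close>, invariant under a
  countable dense subgroup of \<^term>\<open>P\<close>, the map \<^term>\<open>f\<close> is continuous, and by Neumann's lemma the
  stabiliser of a finite algebraically closed \<^term>\<open>B\<close> has dense orbits in the fibres of
  \<open>x \<mapsto> x|B\<close>. A fusion argument shows that, after moving \<^term>\<open>x\<close> by the subgroup, each real
  listed by \<^term>\<open>f x\<close> sits at a position \<^term>\<open>m\<close> such that \<open>f y m\<close> depends only on \<open>y|B\<close> for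
  some finite closed \<^term>\<open>B\<close>. If this value is not locally constant, freeness provides
  \<open>n + 1\<close> translates of \<^term>\<open>B\<close>, hence \<open>n + 1\<close> reals in the range of \<^term>\<open>f x\<close>; by the dimension
  bound the position of one of them, say the \<open>i\<close>-th, is algebraic over the positions of the others.
  Moving \<^term>\<open>x\<close> by the stabiliser of the algebraic closure of the other translates then leaves only
  finitely many values for the \<open>i\<close>-th real, although its own translate moves freely. So the
  range of \<^term>\<open>f x\<close> is generically a fixed countable set \<^term>\<open>T\<close>, and whether a given finite
  tuple from \<^term>\<open>T\<close> sits at given positions modulo \<^term>\<open>Q\<close> is invariant, hence generically
  decided; as \<^term>\<open>Q\<close> is closed this determines the class of \<^term>\<open>f x\<close>.
\<close>

section \<open>Baire category in the sequence space\<close>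

lemma nowhere_dense_iff:
  fixes S :: "'a::topological_space set"
  shows "nowhere_dense_in euclidean S \<longleftrightarrow>
    (\<forall>U. open U \<longrightarrow> U \<noteq> {} \<longrightarrow> (\<exists>V\<subseteq>U. open V \<and> V \<noteq> {} \<and> V \<inter> S = {}))"
    (is "?L \<longleftrightarrow> ?R")
proof
  assume L: ?L
  show ?R
  proof (intro allI impI)
    fix U :: "'a set" assume U: "open U" "U \<noteq> {}"
    have "\<not> U \<subseteq> closure S"
      using L U interior_maximal[of U "closure S"]
      by (auto simp: nowhere_dense_in_def)
    then have "U - closure S \<noteq> {}" by blast
    moreover have "open (U - closure S)" using U by (simp add: open_Diff)
    moreover have "(U - closure S) \<inter> S = {}" using closure_subset by blast
    ultimately show "\<exists>V\<subseteq>U. open V \<and> V \<noteq> {} \<and> V \<inter> S = {}" by blast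
  qed
next
  assume R: ?R
  show ?L
  proof (rule ccontr)
    assume "\<not> ?L"
    then have "interior (closure S) \<noteq> {}" by (auto simp: nowhere_dense_in_def)
    with R obtain V where V: "V \<subseteq> interior (closure S)" "open V" "V \<noteq> {}" "V \<inter> S = {}"
      by (meson open_interior)
    then have "V \<inter> closure S = {}" by (simp add: open_Int_closure_eq_empty)
    with V interior_subset show False by blast
  qed
qed

lemma meager_subset:
  "meager_in X S \<Longrightarrow> R \<subseteq> S \<Longrightarrow> meager_in X R"
  unfolding meager_in_def by (meson order_trans)

lemma nowhere_dense_imp_meager: "nowhere_dense_in X S \<Longrightarrow> meager_in X S"
  unfolding meager_in_def by (rule exI[of _ "{S}"]) auto

lemma meager_UN:
  assumes "countable I" "\<And>i. i \<in> I \<Longrightarrow> meager_in X (S i)"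
  shows "meager_in X (\<Union>i\<in>I. S i)"
proof -
  have "\<forall>i\<in>I. \<exists>F. countable F \<and> (\<forall>T\<in>F. nowhere_dense_in X T) \<and> S i \<subseteq> \<Union>F"
    using assms(2) unfolding meager_in_def by blast
  from bchoice[OF this] obtain F where
    F: "\<forall>i\<in>I. countable (F i) \<and> (\<forall>T\<in>F i. nowhere_dense_in X T) \<and> S i \<subseteq> \<Union>(F i)" ..
  show ?thesis
    unfolding meager_in_def
  proof (intro exI conjI)
    show "countable (\<Union>i\<in>I. F i)" using F assms(1) by blast
    show "\<forall>T\<in>(\<Union>i\<in>I. F i). nowhere_dense_in X T" using F by blast
    show "(\<Union>i\<in>I. S i) \<subseteq> \<Union>(\<Union>i\<in>I. F i)" using F by blast
  qed
qed

lemma meager_Un: "meager_in X S \<Longrightarrow> meager_in X R \<Longrightarrow> meager_in X (S \<union> R)"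
  using meager_UN[of "UNIV :: bool set" X "\<lambda>b. if b then S else R"]
  by (simp add: UNIV_bool Un_commute)

lemma open_not_meager:
  fixes U :: "'a::complete_space set"
  assumes "open U" "U \<noteq> {}"
  shows "\<not> meager_in euclidean U"
proof
  assume "meager_in euclidean U"
  then obtain F where F: "countable F" "\<And>T. T \<in> F \<Longrightarrow> nowhere_dense_in euclidean T" "U \<subseteq> \<Union>F"
    unfolding meager_in_def by blast
  have "euclidean interior_of \<Union>(closure ` F) = {}"
    using F by (intro Baire_category_alt)
      (auto simp: completely_metrizable_space_euclidean nowhere_dense_in_def)
  moreover have "\<Union>F \<subseteq> \<Union>(closure ` F)"
  proof (rule Union_least)
    fix X assume "X \<in> F"
    then have "closure X \<subseteq> \<Union>(closure ` F)" by blast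
    with closure_subset[of X] show "X \<subseteq> \<Union>(closure ` F)" by (rule order_trans)
  qed
  then have "U \<subseteq> interior (\<Union>(closure ` F))"
    using F(3) assms(1) by (intro interior_maximal) (rule order_trans)
  ultimately show False using assms(2) by simp
qed

text \<open>If no piece were dense in a nonempty open subset of \<open>U\<close>, each
  \<open>M i \<inter> U\<close> would be nowhere dense and \<open>U\<close> itself meager.\<close>

lemma baire_cover:
  fixes C :: "'a::complete_space set"
  assumes "meager_in euclidean (- C)" "open U" "U \<noteq> {}" "countable I"
    and cover: "C \<inter> U \<subseteq> (\<Union>i\<in>I. M i)"
  shows "\<exists>i\<in>I. \<exists>V\<subseteq>U. open V \<and> V \<noteq> {} \<and> (\<forall>V'\<subseteq>V. open V' \<longrightarrow> V' \<noteq> {} \<longrightarrow> V' \<inter> M i \<noteq> {})"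
proof (rule ccontr)
  assume neg: "\<not> ?thesis"
  have "nowhere_dense_in euclidean (M i \<inter> U)" if i: "i \<in> I" for i
    unfolding nowhere_dense_iff
  proof (intro allI impI)
    fix V :: "'a set" assume V: "open V" "V \<noteq> {}"
    show "\<exists>V'\<subseteq>V. open V' \<and> V' \<noteq> {} \<and> V' \<inter> (M i \<inter> U) = {}"
    proof (cases "V \<inter> U = {}")
      case True
      then show ?thesis using V by blast
    next
      case False
      have "open (V \<inter> U)" using V assms(2) by blast
      with neg i False obtain V' where "V' \<subseteq> V \<inter> U" "open V'" "V' \<noteq> {}" "V' \<inter> M i = {}"
        by (metis Int_lower2)
      then show ?thesis by blast
    qed
  qed
  then have "meager_in euclidean (\<Union>i\<in>I. M i \<inter> U)"
    by (intro meager_UN nowhere_dense_imp_meager assms)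
  then have "meager_in euclidean (- C \<union> (\<Union>i\<in>I. M i \<inter> U))"
    by (intro meager_Un assms)
  then have "meager_in euclidean U"
    by (rule meager_subset) (use cover in blast)
  then show False using open_not_meager assms by blast
qed

text \<open>Upgrades agreement on a dense set, as supplied by Baire category, to agreement on all of
  \<open>U \<inter> C\<close>: separate two distinct values and shrink the neighbourhood.\<close>

lemma eq_on_dense:
  fixes u v :: "'a::topological_space \<Rightarrow> 'b::t2_space"
  assumes "continuous_on C u" "continuous_on C v" "open U"
    and dense: "\<And>V. V \<subseteq> U \<Longrightarrow> open V \<Longrightarrow> V \<noteq> {} \<Longrightarrow> \<exists>x\<in>V \<inter> C. u x = v x"
    and x: "x \<in> U \<inter> C"
  shows "u x = v x"
proof (rule ccontr)
  assume "u x \<noteq> v x"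
  then obtain A B where AB: "open A" "open B" "u x \<in> A" "v x \<in> B" "A \<inter> B = {}"
    by (meson hausdorff)
  obtain A' where A': "open A'" "x \<in> A'" "\<forall>y\<in>C. y \<in> A' \<longrightarrow> u y \<in> A"
    using assms(1) AB x unfolding continuous_on_topological by (metis IntD2)
  obtain B' where B': "open B'" "x \<in> B'" "\<forall>y\<in>C. y \<in> B' \<longrightarrow> v y \<in> B"
    using assms(2) AB x unfolding continuous_on_topological by (metis IntD2)
  have "\<exists>y\<in>(U \<inter> A' \<inter> B') \<inter> C. u y = v y"
    using x A' B' assms(3) by (intro dense) auto
  then show False using A' B' AB by (metis Int_iff disjoint_iff)
qed

section \<open>Boxes constraining finitely many coordinates\<close>

definition near :: "nat set \<Rightarrow> real \<Rightarrow> (nat \<Rightarrow> real) \<Rightarrow> (nat \<Rightarrow> real) set" where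
  "near F e x = {y. \<forall>a\<in>F. \<bar>y a - x a\<bar> < e}"

lemma open_near: "finite F \<Longrightarrow> open (near F e x)"
proof -
  assume F: "finite F"
  have "near F e x = {y. \<forall>a\<in>F. y (id a) \<in> {x a - e<..<x a + e}}"
    by (auto simp: near_def abs_less_iff algebra_simps)
  then show ?thesis
    using product_topology_basis'[of F "\<lambda>a. {x a - e<..<x a + e}" id] F by simp
qed

lemma open_contains_near:
  assumes "open U" "x \<in> U"
  obtains N e where "e > 0" "near {..<N} e x \<subseteq> U"
proof -
  obtain X where X: "x \<in> Pi\<^sub>E UNIV X" "\<And>i. open (X i)" "finite {i. X i \<noteq> UNIV}" "Pi\<^sub>E UNIV X \<subseteq> U"
    using product_topology_open_contains_basis[of "\<lambda>i. euclidean" UNIV U x] assms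
    by (auto simp: euclidean_product_topology)
  define J where "J = {i. X i \<noteq> UNIV}"
  have "\<forall>i. \<exists>e>0. ball (x i) e \<subseteq> X i" using X(1,2) by (auto simp: open_contains_ball)
  then obtain E where E: "\<And>i. E i > 0" "\<And>i. ball (x i) (E i) \<subseteq> X i" by metis
  define e where "e = Min (insert 1 (E ` J))"
  have J: "finite J" using X(3) J_def by simp
  have "e > 0" unfolding e_def using J E by auto
  have eE: "e \<le> E i" if "i \<in> J" for i unfolding e_def using J that by auto
  obtain N where N: "J \<subseteq> {..<N}" using J finite_nat_iff_bounded by blast
  have "near {..<N} e x \<subseteq> U"
  proof
    fix y assume y: "y \<in> near {..<N} e x"
    have "y i \<in> X i" for i
    proof (cases "i \<in> J")
      case True
      then have "\<bar>y i - x i\<bar> < e" using y N unfolding near_def by blast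
      then have "dist (x i) (y i) < E i" using eE[OF True] by (simp add: dist_real_def)
      then show ?thesis using E by (auto simp: ball_def)
    qed (auto simp: J_def)
    then show "y \<in> U" using X(4) by (auto simp: PiE_iff)
  qed
  with \<open>e > 0\<close> that show thesis by blast
qed

section \<open>Permutation groups\<close>

lemma pgroup:
  assumes "polish_perm_group P"
  shows "\<And>g. g \<in> P \<Longrightarrow> bij g" "id \<in> P" "\<And>g h. g \<in> P \<Longrightarrow> h \<in> P \<Longrightarrow> g \<circ> h \<in> P"
    "\<And>g. g \<in> P \<Longrightarrow> inv g \<in> P"
  using assms unfolding polish_perm_group_def by auto

text \<open>\<open>P\<close> is closed only relative to the bijections, so \<open>g\<close> must be
  known to be bijective; the approximations then converge to it pointwise.\<close>

lemma pgroup_closed: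
  assumes P: "polish_perm_group P" and g: "bij g"
    and lim: "\<And>N. \<exists>h\<in>P. \<forall>a<N. h a = g a"
  shows "g \<in> P"
proof -
  obtain h where h: "\<And>N. h N \<in> P" "\<And>N a. a < N \<Longrightarrow> h N a = g a" using lim by metis
  obtain S where S: "closed S" "P = {g. bij g} \<inter> S"
    using P unfolding polish_perm_group_def closedin_closed by metis
  have "h \<longlonglongrightarrow> g"
    unfolding tendsto_def
  proof (intro allI impI)
    fix U :: "(nat \<Rightarrow> nat) set" assume U: "open U" "g \<in> U"
    obtain X where X: "g \<in> Pi\<^sub>E UNIV X" "finite {i. X i \<noteq> UNIV}" "Pi\<^sub>E UNIV X \<subseteq> U"
      using product_topology_open_contains_basis[of "\<lambda>i. euclidean" UNIV U g] U
      by (auto simp: euclidean_product_topology)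
    obtain M where M: "{i. X i \<noteq> UNIV} \<subseteq> {..<M}" using X(2) finite_nat_iff_bounded by blast
    have "h N \<in> U" if "N \<ge> M" for N
    proof -
      have "h N i \<in> X i" for i
      proof (cases "i < M")
        case True
        then show ?thesis using h(2)[of i N] that X(1) by (auto simp: PiE_iff)
      qed (use M in auto)
      then show ?thesis using X(3) by (auto simp: PiE_iff)
    qed
    then show "eventually (\<lambda>N. h N \<in> U) sequentially" by (auto simp: eventually_sequentially)
  qed
  then have "g \<in> S"
    using closed_sequentially[OF S(1)] h(1) S(2) by blast
  then show ?thesis using S g by blast
qed

section \<open>The shift action and category\<close>

lemma bshift_comp: "bij g \<Longrightarrow> bij h \<Longrightarrow> bshift (g \<circ> h) x = bshift g (bshift h x)"
  by (simp add: bshift_def o_inv_distrib)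

lemma bshift_inv: "bij g \<Longrightarrow> bshift (inv g) x = (\<lambda>a. x (g a))"
  by (simp add: bshift_def inv_inv_eq)

lemma bshift_id [simp]: "bshift id x = x"
  by (simp add: bshift_def)

lemma bshift_cancel:
  assumes "bij g"
  shows "bshift (inv g) (bshift g x) = x" "bshift g (bshift (inv g) x) = x"
  using assms by (auto simp: bshift_def inv_inv_eq bij_is_inj bij_is_surj surj_f_inv_f)

lemma continuous_on_bshift: "continuous_on S (bshift g)"
  unfolding bshift_def
  by (intro continuous_on_coordinatewise_then_product)
    (rule continuous_on_subset[OF continuous_on_product_coordinates], simp)

lemma open_vimage_bshift: "open U \<Longrightarrow> open (bshift g -` U)"
  using continuous_on_bshift[of UNIV g] open_vimage by blast

lemma nowhere_dense_vimage_bshift: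
  assumes "nowhere_dense_in euclidean S" "bij g"
  shows "nowhere_dense_in euclidean (bshift g -` S)"
  unfolding nowhere_dense_iff
proof (intro allI impI)
  fix U :: "(nat \<Rightarrow> real) set" assume U: "open U" "U \<noteq> {}"
  have "bshift (inv g) -` U \<noteq> {}"
    using U(2) bshift_cancel(1)[OF assms(2)] by (metis ex_in_conv vimageI)
  then obtain V where V: "V \<subseteq> bshift (inv g) -` U" "open V" "V \<noteq> {}" "V \<inter> S = {}"
    using assms(1) open_vimage_bshift[OF U(1)] unfolding nowhere_dense_iff by meson
  have "bshift g -` V \<subseteq> U" using V(1) bshift_cancel(1)[OF assms(2)] by fastforce
  moreover have "bshift g -` V \<noteq> {}"
    using V(3) bshift_cancel(2)[OF assms(2)] by (metis ex_in_conv vimageI)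
  ultimately show "\<exists>V\<subseteq>U. open V \<and> V \<noteq> {} \<and> V \<inter> bshift g -` S = {}"
    using V open_vimage_bshift[OF V(2)] by blast
qed

section \<open>Pointwise stabilisers and algebraic closure\<close>

lemma pstab_group:
  assumes P: "polish_perm_group P"
  shows "g \<in> pstab P A \<Longrightarrow> bij g" "id \<in> pstab P A"
    "g \<in> pstab P A \<Longrightarrow> h \<in> pstab P A \<Longrightarrow> g \<circ> h \<in> pstab P A"
    "g \<in> pstab P A \<Longrightarrow> inv g \<in> pstab P A"
proof -
  show "g \<in> pstab P A \<Longrightarrow> bij g" "id \<in> pstab P A"
    "g \<in> pstab P A \<Longrightarrow> h \<in> pstab P A \<Longrightarrow> g \<circ> h \<in> pstab P A"
    using pgroup[OF P] by (auto simp: pstab_def)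
  assume g: "g \<in> pstab P A"
  then have "inv g a = a" if "a \<in> A" for a
    using that pgroup(1)[OF P, of g] by (auto simp: pstab_def intro: inv_f_eq bij_is_inj)
  then show "inv g \<in> pstab P A" using g pgroup(4)[OF P] by (auto simp: pstab_def)
qed

lemma acl_superset: "A \<subseteq> acl P A"
proof
  fix a assume "a \<in> A"
  then have "(\<lambda>g. g a) ` pstab P A \<subseteq> {a}" by (auto simp: pstab_def)
  then show "a \<in> acl P A" unfolding acl_def using finite_subset by blast
qed

lemma acl_mono: "A \<subseteq> B \<Longrightarrow> acl P A \<subseteq> acl P B"
proof
  fix x assume "A \<subseteq> B" "x \<in> acl P A"
  moreover from this have "(\<lambda>g. g x) ` pstab P B \<subseteq> (\<lambda>g. g x) ` pstab P A"
    by (auto simp: pstab_def)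
  ultimately show "x \<in> acl P B" unfolding acl_def using finite_subset by blast
qed

text \<open>The restrictions of elements of \<^term>\<open>pstab P A\<close> to the finite set \<^term>\<open>acl P A\<close> take finitely
  many values, i.e. \<^term>\<open>pstab P (acl P A)\<close> has finite index in \<^term>\<open>pstab P A\<close>.\<close>

lemma acl_idem:
  assumes P: "polish_perm_group P" and fin: "finite (acl P A)"
  shows "acl P (acl P A) = acl P A"
proof
  show "acl P A \<subseteq> acl P (acl P A)" by (rule acl_superset)
  show "acl P (acl P A) \<subseteq> acl P A"
  proof
    fix a assume a: "a \<in> acl P (acl P A)"
    define B where "B = acl P A"
    define R where "R h = restrict h B" for h :: "nat \<Rightarrow> nat"
    define orb where "orb b = (\<lambda>g. g b) ` pstab P A" for b
    have "R ` pstab P A \<subseteq> Pi\<^sub>E B orb" unfolding R_def orb_def by auto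
    moreover have "finite (Pi\<^sub>E B orb)"
      using fin by (intro finite_PiE) (auto simp: B_def acl_def orb_def)
    ultimately have finR: "finite (R ` pstab P A)" by (rule finite_subset)
    \<comment> \<open>Each \<open>h\<close> factors as \<open>rep (R h)\<close> after an element of
      \<open>pstab P B\<close>, so finitely many images of a finite orbit cover the orbit of
      \<open>a\<close>.\<close>
    define rep where "rep s = (SOME h. h \<in> pstab P A \<and> R h = s)" for s
    have rep: "rep (R h) \<in> pstab P A \<and> R (rep (R h)) = R h" if "h \<in> pstab P A" for h
      unfolding rep_def by (rule someI[where x = h]) (use that in auto)
    have "(\<lambda>g. g a) ` pstab P A \<subseteq>
        (\<Union>s\<in>R ` pstab P A. rep s ` ((\<lambda>g. g a) ` pstab P B))"
    proof safe
      fix h assume h: "h \<in> pstab P A"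
      define k where "k = rep (R h)"
      have k: "k \<in> pstab P A" "\<And>b. b \<in> B \<Longrightarrow> k b = h b"
        using rep[OF h] unfolding k_def R_def by (simp, metis restrict_apply')
      have bk: "bij k" using pstab_group(1)[OF P k(1)] .
      have "inv k \<circ> h \<in> pstab P A" by (intro pstab_group[OF P] h k)
      then have "inv k \<circ> h \<in> pstab P B"
        unfolding pstab_def using bk by (simp add: bij_is_inj flip: k(2))
      moreover have "h a = k ((inv k \<circ> h) a)" using bk by (simp add: bij_is_surj surj_f_inv_f)
      ultimately show "h a \<in> (\<Union>s\<in>R ` pstab P A. rep s ` ((\<lambda>g. g a) ` pstab P B))"
        using h unfolding k_def by blast
    qed
    moreover have "finite ((\<lambda>g. g a) ` pstab P B)"
      using a unfolding B_def by (subst (asm) acl_def) simp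
    then have "finite (\<Union>s\<in>R ` pstab P A. rep s ` ((\<lambda>g. g a) ` pstab P B))"
      using finR by (metis finite_UN_I finite_imageI)
    ultimately show "a \<in> acl P A" unfolding acl_def using finite_subset by blast
  qed
qed

text \<open>Neumann's lemma. If every element of \<^term>\<open>G\<close> moved \<^term>\<open>a\<close> or \<^term>\<open>F\<close> into
  \<^term>\<open>D\<close>, then, taking \<^term>\<open>g0\<close> with \<^term>\<open>g0 a \<notin> D\<close>, every element of the coset
  \<^term>\<open>{g \<in> G. g a = d}\<close> would move \<^term>\<open>F\<close> into a fixed finite set, so the conditions on
  \<^term>\<open>a\<close> can be traded for conditions on \<^term>\<open>F\<close>.\<close>

lemma neumann:
  assumes G: "\<And>g. g \<in> G \<Longrightarrow> bij g" "\<And>g h. g \<in> G \<Longrightarrow> h \<in> G \<Longrightarrow> g \<circ> h \<in> G"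
      "\<And>g. g \<in> G \<Longrightarrow> inv g \<in> G" "id \<in> G"
    and F: "finite F" "\<And>a. a \<in> F \<Longrightarrow> infinite ((\<lambda>g. g a) ` G)"
    and D: "finite D"
  shows "\<exists>g\<in>G. g ` F \<inter> D = {}"
  using F D
proof (induction F arbitrary: D rule: finite_induct)
  case empty
  then show ?case using G(4) by auto
next
  case (insert a F)
  have "\<not> (\<lambda>g. g a) ` G \<subseteq> D" using insert.prems finite_subset by blast
  then obtain g0 where g0: "g0 \<in> G" "g0 a \<notin> D" by blast
  define xd where "xd d = (SOME x. x \<in> G \<and> x a = d)" for d
  have xd: "xd (g a) \<in> G \<and> xd (g a) a = g a" if "g \<in> G" for g
    unfolding xd_def by (rule someI[where x = g]) (use that in auto)
  \<comment> \<open>Beyond \<open>D\<close>, this contains the points that the correction made below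
    when \<open>g a\<close> falls in \<open>D\<close> would carry into \<open>D\<close>.\<close>
  define D' where "D' = D \<union> (\<Union>d\<in>D. xd d ` inv g0 ` D)"
  have "finite D'" unfolding D'_def using insert.prems by auto
  then obtain g where g: "g \<in> G" "g ` F \<inter> D' = {}" using insert by (metis insertCI)
  show ?case
  proof (cases "g a \<in> D")
    case False
    then show ?thesis using g unfolding D'_def by (intro bexI[of _ g]) auto
  next
    case True
    define x where "x = xd (g a)"
    have x: "x \<in> G" "x a = g a" using xd[OF g(1)] by (auto simp: x_def)
    \<comment> \<open>The factor \<open>inv x \<circ> g\<close> fixes \<open>a\<close>, so
      \<open>h a = g0 a\<close> lies outside \<open>D\<close>.\<close>
    define h where "h = g0 \<circ> (inv x \<circ> g)"
    have h: "h \<in> G" unfolding h_def by (intro G g0 g x)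
    have "h a = g0 a"
      using G(1)[OF x(1)] by (simp add: h_def bij_is_inj flip: x(2))
    moreover have "h b \<notin> D" if b: "b \<in> F" for b
    proof
      assume "h b \<in> D"
      have "x (inv g0 (h b)) = g b"
        using G(1)[OF x(1)] G(1)[OF g0(1)]
        by (simp add: h_def bij_is_inj bij_is_surj surj_f_inv_f)
      then have "g b \<in> xd (g a) ` inv g0 ` D" using \<open>h b \<in> D\<close> unfolding x_def by force
      then have "g b \<in> D'" using True unfolding D'_def by blast
      then show False using g(2) b by blast
    qed
    ultimately show ?thesis using h g0(2) by (intro bexI[of _ h]) auto
  qed
qed

section \<open>Generic points of a homomorphism\<close>

text \<open>Comeagerness survives intersecting only countably many translates, hence the countable
  \<open>\<Gamma>\<close>, while \<open>hom\<close> holds on all of \<open>P\<close>.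
  \<open>C_Gdelta\<close> puts fusion limits back into \<open>C\<close>; \<open>fibre\<close> is
  density of stabiliser orbits among the points agreeing with \<open>x\<close> on
  \<open>B\<close>.\<close>

locale shift_hom =
  fixes P Q \<Gamma> :: "(nat \<Rightarrow> nat) set" and C :: "(nat \<Rightarrow> real) set"
    and f :: "(nat \<Rightarrow> real) \<Rightarrow> nat \<Rightarrow> real" and n :: nat
  assumes P: "polish_perm_group P" and Q: "polish_perm_group Q"
    and lf: "locally_finite_pg P" and free: "n_free (Suc n) P" and dim: "alg_dim_prop Q n"
    and inj_f: "inj (f x)"
    and hom: "g \<in> P \<Longrightarrow> \<exists>q\<in>Q. f (bshift g x) = bshift q (f x)"
    and \<Gamma>_sub: "\<Gamma> \<subseteq> P" and \<Gamma>_id: "id \<in> \<Gamma>"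
    and \<Gamma>_comp: "g \<in> \<Gamma> \<Longrightarrow> h \<in> \<Gamma> \<Longrightarrow> g \<circ> h \<in> \<Gamma>"
    and \<Gamma>_inv: "g \<in> \<Gamma> \<Longrightarrow> inv g \<in> \<Gamma>"
    and \<Gamma>_countable: "countable \<Gamma>"
    and \<Gamma>_dense: "g \<in> P \<Longrightarrow> finite F \<Longrightarrow> \<exists>h\<in>\<Gamma>. \<forall>a\<in>F. h a = g a"
    and C_Gdelta: "\<exists>W :: nat \<Rightarrow> (nat \<Rightarrow> real) set. (\<forall>i. open (W i)) \<and> C = (\<Inter>i. W i)"
    and C_comeager: "meager_in euclidean (- C)"
    and C_inv: "x \<in> C \<Longrightarrow> g \<in> \<Gamma> \<Longrightarrow> bshift g x \<in> C"
    and fibre: "x \<in> C \<Longrightarrow> finite B \<Longrightarrow> acl P B \<subseteq> B \<Longrightarrow> open U \<Longrightarrow> y \<in> U \<Longrightarrow>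
      (\<And>b. b \<in> B \<Longrightarrow> y b = x b) \<Longrightarrow> \<exists>h\<in>\<Gamma>. (\<forall>b\<in>B. h b = b) \<and> bshift h x \<in> U"
    and cont: "continuous_on C (\<lambda>x. f x k)"
begin

lemma \<Gamma>_bij: "g \<in> \<Gamma> \<Longrightarrow> bij g"
  using pgroup(1)[OF P] \<Gamma>_sub by blast

lemma \<Gamma>_inv_fix: "g \<in> \<Gamma> \<Longrightarrow> g b = b \<Longrightarrow> inv g b = b"
  using \<Gamma>_bij by (metis bij_inv_eq_iff)

lemma bshift_fix: "g \<in> \<Gamma> \<Longrightarrow> g b = b \<Longrightarrow> bshift g x b = x b"
  by (simp add: bshift_def \<Gamma>_inv_fix)

lemma C_dense: "open U \<Longrightarrow> U \<noteq> {} \<Longrightarrow> U \<inter> C \<noteq> {}"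
  using C_comeager meager_subset[of euclidean "- C" U] open_not_meager by blast

lemma cont_nbhd:
  assumes "x \<in> C" "open V" "f x m \<in> V"
  obtains U where "open U" "x \<in> U" "\<And>y. y \<in> C \<Longrightarrow> y \<in> U \<Longrightarrow> f y m \<in> V"
  using cont[of m] assms unfolding continuous_on_topological by metis

lemma range_bshift:
  assumes "g \<in> P"
  shows "range (f (bshift g x)) = range (f x)"
proof -
  obtain q where q: "q \<in> Q" "f (bshift g x) = bshift q (f x)" using hom assms by blast
  have "range (inv q) = UNIV"
    using pgroup[OF Q] q(1) by (simp add: bij_is_surj)
  moreover have "range (bshift q (f x)) = f x ` range (inv q)" by (auto simp: bshift_def)
  ultimately show ?thesis using q(2) by simp
qed

text \<open>Freeness at the empty set makes \<open>acl P {}\<close> disjoint from itself. Hence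
  \<open>fibre\<close> applies with empty \<open>B\<close> and yields dense orbits.\<close>

lemma acl_empty: "acl P {} = {}"
proof -
  obtain g :: "nat \<Rightarrow> nat \<Rightarrow> nat" where
    "\<forall>i<Suc n. acl P (g i ` {}) \<inter> acl P (\<Union>j\<in>{j. j < Suc n \<and> j \<noteq> i}. g j ` {}) = {}"
    using free unfolding n_free_def by (meson finite.emptyI)
  then show ?thesis by auto
qed

lemma dense_orbit: "x \<in> C \<Longrightarrow> open U \<Longrightarrow> U \<noteq> {} \<Longrightarrow> \<exists>h\<in>\<Gamma>. bshift h x \<in> U"
  using fibre[of x "{}" U] acl_empty by auto

text \<open>If no finite piece of \<^term>\<open>g\<close> froze the position of the real \<^term>\<open>f x k\<close> inside
  \<^term>\<open>f (bshift g x)\<close>, a fusion would produce \<^term>\<open>g \<in> P\<close> with \<^term>\<open>f x k\<close> missing from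
  \<^term>\<open>f (bshift g x)\<close>.\<close>

lemma frozen_position:
  assumes x: "x \<in> C"
  shows "\<exists>g\<in>\<Gamma>. \<exists>A m. finite A \<and> f (bshift g x) m = f x k \<and>
    (\<forall>h\<in>\<Gamma>. (\<forall>a\<in>A. h a = a) \<longrightarrow> f (bshift h (bshift g x)) m = f x k)"
proof (rule ccontr)
  assume neg: "\<not> ?thesis"
  obtain W where W: "\<And>i::nat. open (W i)" "C = (\<Inter>i. W i)" using C_Gdelta by blast
  \<comment> \<open>Stage \<open>i\<close> of the fusion: agreement on the finite set
    \<open>A\<close> forces membership in \<open>W i\<close> and keeps \<open>f x k\<close> away
    from position \<open>i\<close>. Including \<open>{..i}\<close> and its image makes the limit a
    bijection.\<close>
  define S where "S i s \<longleftrightarrow> (case s of (g, A) \<Rightarrow> g \<in> \<Gamma> \<and> finite A \<and> {..i} \<subseteq> A \<and> g ` {..i} \<subseteq> A \<and>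
    (\<forall>y. (\<forall>a\<in>A. y a = bshift g x a) \<longrightarrow> y \<in> W i \<and> (y \<in> C \<longrightarrow> f y i \<noteq> f x k)))"
    for i :: nat and s :: "(nat \<Rightarrow> nat) \<times> nat set"
  \<comment> \<open>Later stages multiply on the left by elements fixing \<open>A\<close>, so values
    already in \<open>A\<close> never change.\<close>
  define R where "R s s' \<longleftrightarrow> (\<exists>h\<in>\<Gamma>. (\<forall>a\<in>snd s. h a = a) \<and> fst s' = h \<circ> fst s \<and> snd s \<subseteq> snd s')"
    for s s' :: "(nat \<Rightarrow> nat) \<times> nat set"
  have step: "\<exists>s'. S i s' \<and> R (g, A) s'" if g: "g \<in> \<Gamma>" and A: "finite A" for g A i
  proof -
    \<comment> \<open>The assumed failure supplies \<open>h\<close> when \<open>f x k\<close> sits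
      at position \<open>i\<close>; otherwise the identity serves.\<close>
    have "\<exists>h\<in>\<Gamma>. (\<forall>a\<in>A. h a = a) \<and> f (bshift h (bshift g x)) i \<noteq> f x k"
    proof (cases "f (bshift g x) i = f x k")
      case True
      then show ?thesis using neg g A by blast
    next
      case False
      then show ?thesis using \<Gamma>_id by (intro bexI[of _ id]) auto
    qed
    then obtain h where h: "h \<in> \<Gamma>" "\<forall>a\<in>A. h a = a" "f (bshift h (bshift g x)) i \<noteq> f x k" by blast
    have hg: "h \<circ> g \<in> \<Gamma>" "bshift (h \<circ> g) x = bshift h (bshift g x)"
      using \<Gamma>_comp h(1) g bshift_comp \<Gamma>_bij by auto
    let ?x' = "bshift (h \<circ> g) x"
    have x': "?x' \<in> C" using C_inv x hg(1) by blast
    obtain U where U: "open U" "?x' \<in> U" "\<And>y. y \<in> C \<Longrightarrow> y \<in> U \<Longrightarrow> f y i \<in> - {f x k}"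
      using cont_nbhd[OF x', of "- {f x k}" i] h(3) hg(2) by auto
    have "open (U \<inter> W i)" "?x' \<in> U \<inter> W i" using U W x' by auto
    then obtain N e where N: "e > 0" "near {..<N} e ?x' \<subseteq> U \<inter> W i"
      by (rule open_contains_near)
    define A' where "A' = A \<union> {..i} \<union> (h \<circ> g) ` {..i} \<union> {..<N}"
    have "S i (h \<circ> g, A')"
      unfolding S_def prod.case
    proof (intro conjI allI impI)
      fix y assume y: "\<forall>a\<in>A'. y a = ?x' a"
      then have "y \<in> near {..<N} e ?x'" unfolding near_def A'_def using N(1) by auto
      then have "y \<in> U" "y \<in> W i" using N by auto
      then show "y \<in> W i" "y \<in> C \<Longrightarrow> f y i \<noteq> f x k" using U(3) by auto
    qed (use hg A in \<open>auto simp: A'_def\<close>)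
    moreover have "R (g, A) (h \<circ> g, A')" unfolding R_def A'_def using h by auto
    ultimately show ?thesis by blast
  qed
  obtain s where s: "\<And>i. S i (s i)" "\<And>i. R (s i) (s (Suc i))"
  proof -
    have "\<exists>s. \<forall>i. S i (s i) \<and> R (s i) (s (Suc i))"
    proof (rule dependent_nat_choice)
      show "\<exists>s. S 0 s" using step[OF \<Gamma>_id, of "{}"] by blast
      show "\<exists>s'. S (Suc i) s' \<and> R s s'" if "S i s" for s i
        using step[of "fst s" "snd s" "Suc i"] that by (cases s) (auto simp: S_def)
    qed
    with that show thesis by blast
  qed
  define g where "g i = fst (s i)" for i
  define A where "A i = snd (s i)" for i
  have S: "g i \<in> \<Gamma>" "{..i} \<subseteq> A i" "g i ` {..i} \<subseteq> A i"
    "\<And>y. (\<forall>a\<in>A i. y a = bshift (g i) x a) \<Longrightarrow> y \<in> W i \<and> (y \<in> C \<longrightarrow> f y i \<noteq> f x k)" for i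
    using s(1)[of i] unfolding S_def g_def A_def by (auto split: prod.splits)
  have R: "\<exists>h\<in>\<Gamma>. (\<forall>a\<in>A i. h a = a) \<and> g (Suc i) = h \<circ> g i" "A i \<subseteq> A (Suc i)" for i
    using s(2)[of i] unfolding R_def g_def A_def by auto
  have stable: "g j c = g i c \<and> g i c \<in> A j" if "i \<le> j" "g i c \<in> A i" for i j c
    using that(1)
  proof (induction j rule: dec_induct)
    case base
    then show ?case using that by simp
  next
    case (step j)
    then show ?case using R[of j] by auto
  qed
  have st: "g j a = g i a" if "a \<le> i" "i \<le> j" for i j a
    using stable[OF that(2), of a] S(3)[of i] that(1) by auto
  \<comment> \<open>The diagonal is the pointwise limit, since \<open>g j a\<close> is constant in
    \<open>j\<close> from stage \<open>a\<close> on.\<close>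
  define h where "h a = g a a" for a
  have h: "h a = g i a" if "a \<le> i" for i a
    unfolding h_def using st[OF _ that] by simp
  \<comment> \<open>Preimages of points of \<open>A j\<close> are frozen too. This gives
    surjectivity, and agreement of \<open>bshift h x\<close> with \<open>bshift (g j) x\<close> on
    \<open>A j\<close>.\<close>
  have h_inv: "h (inv (g j) a) = a" if a: "a \<in> A j" for a j
  proof -
    let ?c = "inv (g j) a" and ?i = "max (inv (g j) a) j"
    have c: "g j ?c = a" using \<Gamma>_bij[OF S(1)[of j]] by (simp add: bij_is_surj surj_f_inv_f)
    then have "g ?i ?c = a" using stable[of j ?i ?c] a by simp
    then show ?thesis using h[of ?c ?i] by simp
  qed
  have bij_h: "bij h"
  proof (rule bijI)
    show "inj h"
    proof (rule injI)
      fix a b assume "h a = h b"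
      then have "g (max a b) a = g (max a b) b" using h[of a "max a b"] h[of b "max a b"] by simp
      then show "a = b" using \<Gamma>_bij[OF S(1)] by (meson bij_is_inj injD)
    qed
    show "surj h"
    proof (rule surjI)
      show "h (inv (g b) b) = b" for b using h_inv[of b b] S(2)[of b] by auto
    qed
  qed
  have hP: "h \<in> P"
  proof (rule pgroup_closed[OF P bij_h])
    show "\<exists>k\<in>P. \<forall>a<N. k a = h a" for N
      using S(1)[of N] \<Gamma>_sub h[of _ N] by (intro bexI[of _ "g N"]) auto
  qed
  have "\<forall>a\<in>A j. bshift h x a = bshift (g j) x a" for j
    unfolding bshift_def using h_inv bij_h by (metis bij_inv_eq_iff)
  then have y: "bshift h x \<in> W j \<and> (bshift h x \<in> C \<longrightarrow> f (bshift h x) j \<noteq> f x k)" for j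
    using S(4)[of j] by blast
  \<comment> \<open>Membership in every \<open>W j\<close> puts the limit in \<open>C\<close>, so no
    position lists \<open>f x k\<close>, against invariance of the range.\<close>
  then have "f (bshift h x) j \<noteq> f x k" for j unfolding W(2) by blast
  then have "f x k \<notin> range (f (bshift h x))" by (metis rangeE)
  then show False using range_bshift[OF hP] by blast
qed

section \<open>Finite supports of listed reals\<close>

definition Z :: "nat \<Rightarrow> nat set \<Rightarrow> (nat \<Rightarrow> real) set" where
  "Z m B = {x \<in> C. \<forall>y\<in>C. (\<forall>b\<in>B. y b = x b) \<longrightarrow> f y m = f x m}"

lemma Z_C: "x \<in> Z m B \<Longrightarrow> x \<in> C"
  unfolding Z_def mem_Collect_eq by (rule conjunct1)

lemma Z_I:
  assumes "x \<in> C" "\<And>y. y \<in> C \<Longrightarrow> \<forall>b\<in>B. y b = x b \<Longrightarrow> f y m = f x m"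
  shows "x \<in> Z m B"
proof -
  have "\<forall>y\<in>C. (\<forall>b\<in>B. y b = x b) \<longrightarrow> f y m = f x m"
    by (intro ballI impI) (rule assms(2))
  with assms(1) show ?thesis unfolding Z_def mem_Collect_eq by (rule conjI)
qed

lemma Z_D:
  assumes x: "x \<in> Z m B" and y: "y \<in> C" and eq: "\<And>b. b \<in> B \<Longrightarrow> y b = x b"
  shows "f y m = f x m"
proof -
  have "\<forall>y\<in>C. (\<forall>b\<in>B. y b = x b) \<longrightarrow> f y m = f x m"
    using x unfolding Z_def mem_Collect_eq by (rule conjunct2)
  from this[rule_format, OF y] eq show ?thesis by blast
qed

lemma Z_transfer:
  assumes x: "x \<in> Z m B" and y: "y \<in> C" and eq: "\<And>b. b \<in> B \<Longrightarrow> y b = x b"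
  shows "y \<in> Z m B"
proof (rule Z_I[OF y])
  fix z assume z: "z \<in> C" "\<forall>b\<in>B. z b = y b"
  then have "f z m = f x m" using eq by (intro Z_D[OF x]) auto
  then show "f z m = f y m" using Z_D[OF x y eq] by simp
qed

lemma finite_support:
  assumes x: "x \<in> C"
  shows "\<exists>g\<in>\<Gamma>. \<exists>m B. finite B \<and> acl P B \<subseteq> B \<and> bshift g x \<in> Z m B \<and> f (bshift g x) m = f x k"
proof -
  obtain g A m where g: "g \<in> \<Gamma>" "finite A" "f (bshift g x) m = f x k"
    "\<And>h. h \<in> \<Gamma> \<Longrightarrow> (\<forall>a\<in>A. h a = a) \<Longrightarrow> f (bshift h (bshift g x)) m = f x k"
    using frozen_position[OF x] by metis
  define B where "B = acl P A"
  have B: "finite B" using lf g(2) unfolding B_def locally_finite_pg_def by blast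
  then have clB: "acl P B \<subseteq> B" unfolding B_def using acl_idem[OF P] by auto
  have gx: "bshift g x \<in> C" using C_inv x g by blast
  have "f y m = f (bshift g x) m" if y: "y \<in> C" "\<forall>b\<in>B. y b = bshift g x b" for y
  proof (rule ccontr)
    assume "f y m \<noteq> f (bshift g x) m"
    then obtain U where U: "open U" "y \<in> U" "\<And>z. z \<in> C \<Longrightarrow> z \<in> U \<Longrightarrow> f z m \<in> - {f x k}"
      using cont_nbhd[OF y(1), of "- {f x k}" m] g(3) by auto
    obtain h where h: "h \<in> \<Gamma>" "\<forall>b\<in>B. h b = b" "bshift h (bshift g x) \<in> U"
      using fibre[OF gx B clB U(1,2)] y(2) by blast
    have "\<forall>a\<in>A. h a = a" using h(2) acl_superset[of A P] unfolding B_def by blast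
    then show False using g(4)[OF h(1)] U(3)[OF C_inv[OF gx h(1)] h(3)] by simp
  qed
  then have "bshift g x \<in> Z m B" by (rule Z_I[OF gx])
  then show ?thesis using g B clB by blast
qed

text \<open>On \<open>Z m B\<close> only the coordinates in \<open>B\<close> matter for continuity,
  since \<open>fibre\<close> adjusts the others without changing the value at
  \<open>m\<close>.\<close>

lemma Z_cont:
  assumes B: "finite B" "acl P B \<subseteq> B" and w: "w \<in> Z m B" and V: "open V" "f w m \<in> V"
  obtains e where "e > 0" "\<And>z. z \<in> Z m B \<Longrightarrow> z \<in> near B e w \<Longrightarrow> f z m \<in> V"
proof -
  have "w \<in> C" using w by (rule Z_C)
  then obtain U where U: "open U" "w \<in> U" "\<And>y. y \<in> C \<Longrightarrow> y \<in> U \<Longrightarrow> f y m \<in> V"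
    using cont_nbhd V by metis
  obtain N e where N: "e > 0" "near {..<N} e w \<subseteq> U" by (rule open_contains_near[OF U(1,2)])
  have "f z m \<in> V" if z: "z \<in> Z m B" "z \<in> near B e w" for z
  proof -
    have zC: "z \<in> C" using z by (metis Z_C)
    define y where "y a = (if a \<in> B then z a else w a)" for a
    have "y \<in> U" using z(2) N by (auto simp: near_def y_def)
    moreover have "\<And>b. b \<in> B \<Longrightarrow> y b = z b" by (simp add: y_def)
    ultimately obtain h where h: "h \<in> \<Gamma>" "\<forall>b\<in>B. h b = b" "bshift h z \<in> U"
      using fibre[OF zC B U(1)] by blast
    have "f (bshift h z) m = f z m"
      using Z_D[OF z(1) C_inv[OF zC h(1)]] h bshift_fix by auto
    then show ?thesis using U(3)[OF C_inv[OF zC h(1)] h(3)] by simp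
  qed
  then show thesis using that N(1) by blast
qed

text \<open>If \<open>x\<close> and \<open>y\<close> agree on \<open>B\<close> but differ at
  \<open>m\<close>, a point \<open>z\<close> of \<open>Z m B\<close> near \<open>x\<close> can be
  shifted close to \<open>y\<close> while its value at \<open>m\<close>, close to that of
  \<open>x\<close>, stays the same.\<close>

lemma Z_closed:
  assumes B: "finite B" "acl P B \<subseteq> B" and U: "open U"
    and dense: "\<And>V. V \<subseteq> U \<Longrightarrow> open V \<Longrightarrow> V \<noteq> {} \<Longrightarrow> V \<inter> Z m B \<noteq> {}"
  shows "U \<inter> C \<subseteq> Z m B"
proof
  fix x assume x: "x \<in> U \<inter> C"
  have "f y m = f x m" if y: "y \<in> C" "\<forall>b\<in>B. y b = x b" for y
  proof (rule ccontr)
    assume "f y m \<noteq> f x m"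
    then obtain V1 V2 where V: "open V1" "open V2" "f x m \<in> V1" "f y m \<in> V2" "V1 \<inter> V2 = {}"
      by (metis hausdorff)
    obtain U1 where U1: "open U1" "x \<in> U1" "\<And>y. y \<in> C \<Longrightarrow> y \<in> U1 \<Longrightarrow> f y m \<in> V1"
      using cont_nbhd[of x V1 m] V x by auto
    obtain U2 where U2: "open U2" "y \<in> U2" "\<And>z. z \<in> C \<Longrightarrow> z \<in> U2 \<Longrightarrow> f z m \<in> V2"
      using cont_nbhd[of y V2 m] V y by auto
    obtain N e where N: "e > 0" "near {..<N} e y \<subseteq> U2" by (rule open_contains_near[OF U2(1,2)])
    have "x \<in> U \<inter> U1 \<inter> near B e x" using x U1 N(1) by (auto simp: near_def)
    moreover have "open (U \<inter> U1 \<inter> near B e x)" using U U1 open_near[OF B(1)] by blast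
    ultimately obtain z where z: "z \<in> U1" "z \<in> near B e x" "z \<in> Z m B"
      using dense[of "U \<inter> U1 \<inter> near B e x"] by blast
    have zC: "z \<in> C" using z by (metis Z_C)
    define w where "w a = (if a \<in> B then z a else y a)" for a
    have "w \<in> U2" using z(2) N y(2) by (intro subsetD[OF N(2)]) (auto simp: near_def w_def)
    moreover have "\<And>b. b \<in> B \<Longrightarrow> w b = z b" by (simp add: w_def)
    ultimately obtain h where h: "h \<in> \<Gamma>" "\<forall>b\<in>B. h b = b" "bshift h z \<in> U2"
      using fibre[OF zC B U2(1)] by blast
    have "f (bshift h z) m = f z m"
      using Z_D[OF z(3) C_inv[OF zC h(1)]] h bshift_fix by auto
    then show False using U2(3)[OF C_inv[OF zC h(1)] h(3)] U1(3)[OF zC z(1)] V(5) by auto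
  qed
  then show "x \<in> Z m B" by (rule Z_I[OF IntD2[OF x]])
qed

section \<open>Common reals and the exclusion of moving supports\<close>

definition T :: "real set" where "T = {r. \<forall>x\<in>C. r \<in> range (f x)}"

lemma const_open_T:
  assumes U: "open U" "U \<noteq> {}" and r: "\<And>x. x \<in> U \<inter> C \<Longrightarrow> f x m = r"
  shows "r \<in> T"
  unfolding T_def
proof safe
  fix x assume x: "x \<in> C"
  obtain h where h: "h \<in> \<Gamma>" "bshift h x \<in> U" using dense_orbit[OF x U] by blast
  then have "f (bshift h x) m = r" using r C_inv[OF x] by blast
  then show "r \<in> range (f x)" using range_bshift[of h x] h(1) \<Gamma>_sub by blast
qed

text \<open>Replaces \<open>U\<close> by a box constraining only \<open>B\<close>, so that the boxes
  for disjoint translates of \<open>B\<close> can be met simultaneously. \<open>fibre\<close>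
  carries points of the box into \<open>U\<close> without changing their restriction to
  \<open>B\<close>.\<close>

lemma cylinder:
  assumes B: "finite B" "acl P B \<subseteq> B" and U: "open U" "U \<noteq> {}" "U \<inter> C \<subseteq> Z m B"
    and nonconst: "\<And>V r. V \<subseteq> U \<Longrightarrow> open V \<Longrightarrow> V \<noteq> {} \<Longrightarrow> \<exists>x\<in>V \<inter> C. f x m \<noteq> r"
  shows "\<exists>x0 e. e > 0 \<and> near B e x0 \<inter> C \<subseteq> Z m B \<and>
    (\<forall>V r. V \<subseteq> near B e x0 \<longrightarrow> open V \<longrightarrow> V \<noteq> {} \<longrightarrow> (\<exists>x\<in>V \<inter> C. f x m \<noteq> r))"
proof -
  obtain x0 where x0: "x0 \<in> U" using U by blast
  obtain N e where N: "e > 0" "near {..<N} e x0 \<subseteq> U" by (rule open_contains_near[OF U(1) x0])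
  have mixU: "(\<lambda>a. if a \<in> B then x a else x0 a) \<in> U" if "x \<in> near B e x0" for x
    using that N(1) by (intro subsetD[OF N(2)]) (auto simp: near_def)
  have "near B e x0 \<inter> C \<subseteq> Z m B"
  proof
    fix x assume x: "x \<in> near B e x0 \<inter> C"
    then obtain h where h: "h \<in> \<Gamma>" "\<forall>b\<in>B. h b = b" "bshift h x \<in> U"
      using fibre[OF _ B U(1) mixU[of x], of x] by auto
    then have "bshift h x \<in> Z m B" using U(3) C_inv x by blast
    then show "x \<in> Z m B" using Z_transfer[of "bshift h x" m B x] h bshift_fix x by auto
  qed
  moreover have "\<exists>x\<in>V \<inter> C. f x m \<noteq> r" if V: "V \<subseteq> near B e x0" "open V" "V \<noteq> {}" for V r
  proof (rule ccontr)
    assume c: "\<not> ?thesis"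
    obtain x1 where x1: "x1 \<in> V" using V by blast
    obtain N' e' where N': "e' > 0" "near {..<N'} e' x1 \<subseteq> V"
      by (rule open_contains_near[OF V(2) x1])
    \<comment> \<open>So this open subset of \<open>U\<close> is nonempty and contains a value other
      than \<open>r\<close>, which \<open>fibre\<close> then moves into \<open>V\<close>.\<close>
    have "(\<lambda>a. if a \<in> B then x1 a else x0 a) \<in> U \<inter> near B e' x1"
      using mixU[of x1] x1 V(1) N'(1) by (auto simp: near_def)
    then obtain x where x: "x \<in> U \<inter> near B e' x1" "x \<in> C" "f x m \<noteq> r"
      using nonconst[of "U \<inter> near B e' x1"] U(1) open_near[OF B(1)] by blast
    have mix: "(\<lambda>a. if a \<in> B then x a else x1 a) \<in> V"
      using x(1) N'(1) by (intro subsetD[OF N'(2)]) (auto simp: near_def)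
    obtain h where h: "h \<in> \<Gamma>" "\<forall>b\<in>B. h b = b" "bshift h x \<in> V"
      using fibre[OF x(2) B V(2) mix] by auto
    have "x \<in> Z m B" using U(3) x by blast
    then have "f (bshift h x) m = f x m"
      by (rule Z_D[OF _ C_inv[OF x(2) h(1)]]) (use h bshift_fix in blast)
    moreover have "f (bshift h x) m = r" using c h(3) C_inv[OF x(2) h(1)] by blast
    ultimately show False using x(3) by simp
  qed
  ultimately show ?thesis using N(1) by blast
qed

text \<open>A repeated position lies in the closure of the others for trivial reasons;
  \<open>Suc n\<close> distinct ones fall under the dimension bound.\<close>

lemma dim_index: "\<exists>i<Suc n. p i \<in> acl Q (p ` ({..<Suc n} - {i}))"
proof (cases "inj_on p {..<Suc n}")
  case True
  then have "card (p ` {..<Suc n}) = Suc n" by (simp add: card_image)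
  then obtain a where a: "a \<in> p ` {..<Suc n}" "a \<in> acl Q (p ` {..<Suc n} - {a})"
    using dim unfolding alg_dim_prop_def by blast
  then obtain i where i: "i < Suc n" "a = p i" by blast
  have "p ` {..<Suc n} - {p i} \<subseteq> p ` ({..<Suc n} - {i})" by blast
  then show ?thesis using a(2) i acl_mono by blast
next
  case False
  then obtain i j where ij: "i < Suc n" "j < Suc n" "i \<noteq> j" "p i = p j"
    by (auto simp: inj_on_def)
  have "p j \<in> p ` ({..<Suc n} - {i})" using ij by (intro imageI) auto
  then have "p i \<in> acl Q (p ` ({..<Suc n} - {i}))"
    using acl_superset[of "p ` ({..<Suc n} - {i})" Q] unfolding ij(4) by (rule subsetD[rotated])
  then show ?thesis using ij(1) by blast
qed

lemma no_moving_support: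
  assumes B: "finite B" "acl P B \<subseteq> B" and U: "open U" "U \<noteq> {}" "U \<inter> C \<subseteq> Z m B"
    and nonconst0: "\<And>V r. V \<subseteq> U \<Longrightarrow> open V \<Longrightarrow> V \<noteq> {} \<Longrightarrow> \<exists>x\<in>V \<inter> C. f x m \<noteq> r"
  shows False
proof -
  have "\<exists>x0 e. e > 0 \<and> near B e x0 \<inter> C \<subseteq> Z m B \<and>
      (\<forall>V r. V \<subseteq> near B e x0 \<longrightarrow> open V \<longrightarrow> V \<noteq> {} \<longrightarrow> (\<exists>x\<in>V \<inter> C. f x m \<noteq> r))"
    by (rule cylinder[OF B U]) (rule nonconst0)
  then obtain x0 e where e: "e > 0" and cyl: "near B e x0 \<inter> C \<subseteq> Z m B"
    and nc: "\<forall>V r. V \<subseteq> near B e x0 \<longrightarrow> open V \<longrightarrow> V \<noteq> {} \<longrightarrow> (\<exists>x\<in>V \<inter> C. f x m \<noteq> r)"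
    by (elim exE conjE)
  note nonconst = nc[rule_format]
  obtain g0 :: "nat \<Rightarrow> nat \<Rightarrow> nat" where g0: "\<forall>i<Suc n. g0 i \<in> P"
    "\<forall>i<Suc n. acl P (g0 i ` B) \<inter> acl P (\<Union>j\<in>{j. j < Suc n \<and> j \<noteq> i}. g0 j ` B) = {}"
    using free[unfolded n_free_def, rule_format, OF B(1)] by (elim exE conjE)
  \<comment> \<open>Freeness gives elements of \<open>P\<close>, but invariance of \<open>C\<close>
    requires elements of \<open>\<Gamma>\<close>; agreement on \<open>B\<close> suffices.\<close>
  have "\<forall>i. \<exists>h. i < Suc n \<longrightarrow> h \<in> \<Gamma> \<and> (\<forall>b\<in>B. h b = g0 i b)"
    using \<Gamma>_dense B(1) g0(1) by meson
  then obtain \<gamma> where \<gamma>: "\<And>i. i < Suc n \<Longrightarrow> \<gamma> i \<in> \<Gamma>"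
    and \<gamma>_eq: "\<And>i b. i < Suc n \<Longrightarrow> b \<in> B \<Longrightarrow> \<gamma> i b = g0 i b" by metis
  have bij\<gamma>: "bij (\<gamma> i)" if "i < Suc n" for i using \<Gamma>_bij \<gamma> that by blast
  \<comment> \<open>\<open>D i\<close> is the closure of the translates other than the
    \<open>i\<close>-th; by freeness the \<open>i\<close>-th translate avoids it.\<close>
  define D where "D i = acl P (\<Union>j\<in>{j. j < Suc n \<and> j \<noteq> i}. \<gamma> j ` B)" for i
  have D: "finite (D i)" "acl P (D i) \<subseteq> D i" for i
  proof -
    have "finite (\<Union>j\<in>{j. j < Suc n \<and> j \<noteq> i}. \<gamma> j ` B)" using B(1) by auto
    then show fin: "finite (D i)" using lf unfolding locally_finite_pg_def D_def by blast
    show "acl P (D i) \<subseteq> D i" using acl_idem[OF P] fin unfolding D_def by blast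
  qed
  have in_D: "\<gamma> j b \<in> D i" if "j < Suc n" "j \<noteq> i" "b \<in> B" for i j b
    using acl_superset[of "\<Union>j\<in>{j. j < Suc n \<and> j \<noteq> i}. \<gamma> j ` B" P] that unfolding D_def by blast
  have not_in_D: "\<gamma> i b \<notin> D i" if i: "i < Suc n" and b: "b \<in> B" for i b
  proof -
    have im: "\<gamma> j ` B = g0 j ` B" if "j < Suc n" for j
      by (rule image_cong[OF refl]) (rule \<gamma>_eq[OF that])
    have "D i = acl P (\<Union>j\<in>{j. j < Suc n \<and> j \<noteq> i}. g0 j ` B)"
      unfolding D_def by (intro arg_cong[where f = "acl P"] SUP_cong refl) (simp add: im)
    moreover have "\<gamma> i b \<in> acl P (g0 i ` B)"
      using acl_superset[of "g0 i ` B" P] im[OF i] b by blast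
    ultimately show ?thesis using g0(2) i by blast
  qed
  \<comment> \<open>Reading \<open>sh j x\<close> on \<open>B\<close> is reading \<open>x\<close> on
    the \<open>j\<close>-th translate, so \<open>f (sh j x) m\<close> is the real which that
    translate contributes to the range of \<open>f x\<close>.\<close>
  define sh where "sh j x = bshift (inv (\<gamma> j)) x" for j and x :: "nat \<Rightarrow> real"
  have sh_apply: "sh j x b = x (\<gamma> j b)" if "j < Suc n" for j x b
    unfolding sh_def by (simp add: bshift_inv bij\<gamma>[OF that])
  have sh_C: "sh j x \<in> C" if "j < Suc n" "x \<in> C" for j x
    unfolding sh_def by (intro C_inv that \<Gamma>_inv \<gamma>)
  have sh_cont: "continuous_on S (sh j)" for S j
    unfolding sh_def by (rule continuous_on_bshift)
  define O2 where "O2 = (\<Inter>j\<in>{..<Suc n}. sh j -` near B e x0)"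
  have "open O2" unfolding O2_def sh_def
    by (intro open_INT ballI open_vimage_bshift open_near B) auto
  have O2_ne: "O2 \<noteq> {}"
  proof -
    \<comment> \<open>Disjointness of the translates lets one point copy \<open>x0\<close> onto all
      of them; \<open>J\<close> recovers the translate containing a coordinate.\<close>
    define J where "J a = (SOME j. j < Suc n \<and> a \<in> \<gamma> j ` B)" for a
    define z where "z a = x0 (inv (\<gamma> (J a)) a)" for a
    have "z (\<gamma> j b) = x0 b" if j: "j < Suc n" and b: "b \<in> B" for j b
    proof -
      have J: "J (\<gamma> j b) < Suc n \<and> \<gamma> j b \<in> \<gamma> (J (\<gamma> j b)) ` B"
        unfolding J_def by (rule someI[where x = j]) (use j b in blast)
      have "J (\<gamma> j b) = j"
      proof (rule ccontr)
        assume "J (\<gamma> j b) \<noteq> j"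
        then have "\<gamma> j b \<in> D j" using J in_D by (metis imageE)
        then show False using not_in_D[OF j b] by blast
      qed
      then show ?thesis unfolding z_def using bij\<gamma>[OF j] by (simp add: bij_is_inj)
    qed
    then have "z \<in> O2" unfolding O2_def near_def using e by (auto simp: sh_apply)
    then show ?thesis by blast
  qed
  have shZ: "sh j x \<in> Z m B" if "j < Suc n" "x \<in> C" "x \<in> O2" for j x
    using sh_C[OF that(1,2)] that(1,3) cyl unfolding O2_def by blast
  \<comment> \<open>\<open>p\<close> records where these reals sit in \<open>f x\<close>; using
    lists keeps the index set countable.\<close>
  define M where "M p = {x \<in> C. \<forall>j<Suc n. f x (p ! j) = f (sh j x) m}" for p :: "nat list"
  have cover: "C \<inter> O2 \<subseteq> (\<Union>p\<in>UNIV. M p)"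
  proof
    fix x assume x: "x \<in> C \<inter> O2"
    have "\<exists>p. f x p = f (sh j x) m" if "j < Suc n" for j
    proof -
      have "inv (\<gamma> j) \<in> P" using \<Gamma>_inv[OF \<gamma>[OF that]] \<Gamma>_sub by blast
      then have "f (sh j x) m \<in> range (f x)" using range_bshift unfolding sh_def by blast
      then show ?thesis by (metis rangeE)
    qed
    then obtain p where p: "\<And>j. j < Suc n \<Longrightarrow> f x (p j) = f (sh j x) m" by metis
    have "x \<in> M (map p [0..<Suc n])"
      unfolding M_def using x p by (auto simp del: upt_Suc)
    then show "x \<in> (\<Union>p\<in>UNIV. M p)" by blast
  qed
  obtain p' U3 where U3: "U3 \<subseteq> O2" "open U3" "U3 \<noteq> {}"
    and U3_dense: "\<And>V. V \<subseteq> U3 \<Longrightarrow> open V \<Longrightarrow> V \<noteq> {} \<Longrightarrow> V \<inter> M p' \<noteq> {}"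
    using baire_cover[OF C_comeager \<open>open O2\<close> O2_ne _ cover] by auto
  define p where "p j = p' ! j" for j
  \<comment> \<open>Positions valid on a dense part of \<open>U3\<close> are valid throughout
    \<open>U3 \<inter> C\<close> by continuity.\<close>
  have pos: "f x (p j) = f (sh j x) m" if x: "x \<in> U3 \<inter> C" and j: "j < Suc n" for x j
  proof (rule eq_on_dense[OF _ _ U3(2) _ x])
    show "continuous_on C (\<lambda>x. f x (p j))" by (rule cont)
    have "continuous_on (sh j ` C) (\<lambda>x. f x m)"
      by (rule continuous_on_subset[OF cont]) (use sh_C[OF j] in blast)
    then show "continuous_on C (\<lambda>x. f (sh j x) m)" by (rule continuous_on_compose2[OF _ sh_cont]) auto
    show "\<exists>x\<in>V \<inter> C. f x (p j) = f (sh j x) m" if "V \<subseteq> U3" "open V" "V \<noteq> {}" for V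
      using U3_dense[OF that] j unfolding M_def p_def by blast
  qed
  obtain i where i: "i < Suc n" "p i \<in> acl Q (p ` ({..<Suc n} - {i}))" using dim_index by blast
  obtain x1 where x1: "x1 \<in> U3" "x1 \<in> C" using C_dense U3 by blast
  obtain N d where N: "d > 0" "near {..<N} d x1 \<subseteq> U3" by (rule open_contains_near[OF U3(2) x1(1)])
  \<comment> \<open>Candidates for the \<open>i\<close>-th real once the other positions are fixed;
    finitely many, as \<open>p i\<close> is algebraic over them.\<close>
  define K where "K = f x1 ` ((\<lambda>q. q (p i)) ` pstab Q (p ` ({..<Suc n} - {i})))"
  have "finite ((\<lambda>q. q (p i)) ` pstab Q (p ` ({..<Suc n} - {i})))" using i(2) by (simp add: acl_def)
  then have K: "finite K" unfolding K_def by (rule finite_imageI)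
  have orbit_K: "f (sh i (bshift h x1)) m \<in> K"
    if h: "h \<in> \<Gamma>" "\<forall>b\<in>D i. h b = b" "bshift h x1 \<in> U3" for h
  proof -
    let ?y = "bshift h x1"
    have y: "?y \<in> C" using C_inv x1 h by blast
    obtain q where q: "q \<in> Q" "f ?y = bshift q (f x1)" using hom h(1) \<Gamma>_sub by blast
    have bq: "bij q" using pgroup(1)[OF Q q(1)] .
    \<comment> \<open>\<open>h\<close> fixes the support of the \<open>j\<close>-th real, so that
      real is unchanged and still sits at \<open>p j\<close>; injectivity of \<open>f x1\<close>
      then makes \<open>p j\<close> a fixed point.\<close>
    have "inv q (p j) = p j" if j: "j < Suc n" "j \<noteq> i" for j
    proof -
      have "f (sh j ?y) m = f (sh j x1) m"
      proof (rule Z_D[OF shZ[OF j(1) x1(2)] sh_C[OF j(1) y]])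
        show "x1 \<in> O2" using x1 U3 by blast
        show "sh j ?y b = sh j x1 b" if "b \<in> B" for b
          using in_D[OF j that] h by (simp add: sh_apply[OF j(1)] bshift_fix)
      qed
      then have "f ?y (p j) = f x1 (p j)" using pos j x1 h(3) y by simp
      then have "bshift q (f x1) (p j) = f x1 (p j)" unfolding q(2) .
      then have "f x1 (inv q (p j)) = f x1 (p j)" unfolding bshift_def .
      then show ?thesis using inj_f by (meson injD)
    qed
    then have "inv q \<in> pstab Q (p ` ({..<Suc n} - {i}))"
      unfolding pstab_def using pgroup(4)[OF Q q(1)] by auto
    moreover have "f (sh i ?y) m = bshift q (f x1) (p i)"
      using pos[of ?y i] h(3) y i(1) unfolding q(2) by simp
    then have "f (sh i ?y) m = f x1 (inv q (p i))" unfolding bshift_def .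
    ultimately show ?thesis unfolding K_def by blast
  qed
  have box_K: "f (sh i x) m \<in> K" if x: "x \<in> near {..<N} d x1" "x \<in> C" for x
  proof (rule ccontr)
    assume "f (sh i x) m \<notin> K"
    then have "f (sh i x) m \<in> - K" by simp
    moreover have "open (- K)" using K by (simp add: finite_imp_closed open_Compl)
    moreover have "sh i x \<in> Z m B" using shZ[OF i(1) x(2)] x(1) N(2) U3(1) by blast
    ultimately obtain e' where e': "e' > 0"
      "\<And>z. z \<in> Z m B \<Longrightarrow> z \<in> near B e' (sh i x) \<Longrightarrow> f z m \<in> - K"
      using Z_cont[OF B] by metis
    \<comment> \<open>\<open>y\<close> copies \<open>x1\<close> on \<open>D i\<close> and
      \<open>x\<close> on the \<open>i\<close>-th translate, which avoids \<open>D i\<close>. So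
      \<open>fibre\<close> shifts \<open>x1\<close> close to \<open>y\<close> while fixing
      \<open>D i\<close>, and the \<open>i\<close>-th real there is both inside and outside
      \<open>K\<close>.\<close>
    define y where "y a = (if a \<in> D i then x1 a else x a)" for a
    let ?V = "near {..<N} d x1 \<inter> sh i -` near B e' (sh i x)"
    have "y \<in> near {..<N} d x1" using x(1) N(1) by (auto simp: near_def y_def)
    moreover have "sh i y \<in> near B e' (sh i x)"
      using e'(1) not_in_D[OF i(1)] by (auto simp: near_def y_def sh_apply[OF i(1)])
    ultimately have yV: "y \<in> ?V" by blast
    have V: "open ?V"
      unfolding sh_def using open_vimage_bshift[OF open_near[OF B(1)]] open_near by blast
    have "y b = x1 b" if "b \<in> D i" for b using that by (simp add: y_def)
    from fibre[OF x1(2) D V yV this] obtain h where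
      h: "h \<in> \<Gamma>" "\<forall>b\<in>D i. h b = b" "bshift h x1 \<in> ?V" by blast
    have hU: "bshift h x1 \<in> U3" using h(3) N(2) by blast
    have "f (sh i (bshift h x1)) m \<in> - K"
    proof (rule e'(2))
      show "sh i (bshift h x1) \<in> Z m B"
        using shZ[OF i(1) C_inv[OF x1(2) h(1)]] hU U3(1) by blast
      show "sh i (bshift h x1) \<in> near B e' (sh i x)" using h(3) by blast
    qed
    then show False using orbit_K[OF h(1,2) hU] by blast
  qed
  \<comment> \<open>Undoing the translation by \<open>\<gamma> i\<close> turns the
    \<open>i\<close>-th real back into \<open>f w m\<close>, which thus takes finitely many values
    on \<open>V0 \<inter> C\<close>.\<close>
  define V0 where "V0 = bshift (\<gamma> i) -` near {..<N} d x1"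
  have sh_bshift: "sh i (bshift (\<gamma> i) w) = w" "bshift (\<gamma> i) (sh i w) = w" for w
    unfolding sh_def using bshift_cancel[OF bij\<gamma>[OF i(1)]] by auto
  have V0: "open V0" unfolding V0_def by (intro open_vimage_bshift open_near) simp
  have "x1 \<in> near {..<N} d x1" using N(1) by (simp add: near_def)
  then have w0: "sh i x1 \<in> V0" "sh i x1 \<in> C"
    unfolding V0_def using sh_bshift sh_C[OF i(1) x1(2)] by auto
  have V0_sub: "V0 \<subseteq> near B e x0"
  proof
    fix w assume "w \<in> V0"
    then have "bshift (\<gamma> i) w \<in> O2" using N(2) U3(1) unfolding V0_def by blast
    then have "sh i (bshift (\<gamma> i) w) \<in> near B e x0" using i(1) unfolding O2_def by blast
    then show "w \<in> near B e x0" by (simp add: sh_bshift)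
  qed
  have V0_K: "f w m \<in> K" if w: "w \<in> V0" "w \<in> C" for w
    using box_K[of "bshift (\<gamma> i) w"] w C_inv[OF w(2) \<gamma>[OF i(1)]] unfolding V0_def sh_bshift by blast
  let ?r = "f (sh i x1) m"
  \<comment> \<open>Continuity excludes the finitely many other values near \<open>sh i x1\<close>,
    making \<open>f w m\<close> locally constant.\<close>
  have "open (- (K - {?r}))" using K by (intro open_Compl finite_imp_closed) simp
  then obtain U4 where U4: "open U4" "sh i x1 \<in> U4"
    "\<And>y. y \<in> C \<Longrightarrow> y \<in> U4 \<Longrightarrow> f y m \<in> - (K - {?r})"
    using cont_nbhd[OF w0(2), of "- (K - {?r})" m] by auto
  have "\<exists>x\<in>(V0 \<inter> U4) \<inter> C. f x m \<noteq> ?r"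
    using nonconst[of "V0 \<inter> U4" ?r] V0_sub V0 U4 w0(1) by blast
  then show False using U4(3) V0_K by blast
qed

text \<open>By \<open>finite_support\<close> the exceptional points are covered by countably many
  shift preimages of sets \<open>Y m B\<close>. Were \<open>Y m B\<close> dense in an open set,
  \<open>B\<close> would be a support throughout it, and the real would be locally constant, hence
  in \<open>T\<close>, or moving, which is excluded.\<close>

lemma generic_range: "meager_in euclidean {x \<in> C. \<not> range (f x) \<subseteq> T}"
proof -
  define Y where "Y m B = {x \<in> Z m B. f x m \<notin> T}" for m B
  have nd: "nowhere_dense_in euclidean (Y m B)" if B: "finite B" "acl P B \<subseteq> B" for m B
  proof (rule ccontr)
    assume "\<not> ?thesis"
    then obtain U where U: "open U" "U \<noteq> {}" "\<And>V. V \<subseteq> U \<Longrightarrow> open V \<Longrightarrow> V \<noteq> {} \<Longrightarrow> V \<inter> Y m B \<noteq> {}"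
      unfolding nowhere_dense_iff by meson
    have "U \<inter> C \<subseteq> Z m B"
      using U(3) by (intro Z_closed[OF B U(1)]) (unfold Y_def, blast)
    moreover have "\<exists>x\<in>V \<inter> C. f x m \<noteq> r" if V: "V \<subseteq> U" "open V" "V \<noteq> {}" for V r
    proof (rule ccontr)
      assume c: "\<not> ?thesis"
      then have "r \<in> T" using const_open_T[OF V(2,3)] by blast
      obtain y where y: "y \<in> V" "y \<in> Z m B" "f y m \<notin> T" using U(3)[OF V] unfolding Y_def by blast
      then have "f y m = r" using c Z_C[OF y(2)] by blast
      then show False using \<open>r \<in> T\<close> y(3) by simp
    qed
    ultimately show False using no_moving_support[OF B U(1,2)] by blast
  qed
  define I where "I = \<Gamma> \<times> (UNIV :: nat set) \<times> {B. finite B \<and> acl P B \<subseteq> B}"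
  have "countable {B. finite (B :: nat set) \<and> acl P B \<subseteq> B}"
    by (rule countable_subset[OF _ countable_Collect_finite]) auto
  then have "countable I" unfolding I_def using \<Gamma>_countable by (intro countable_SIGMA) auto
  then have "meager_in euclidean (\<Union>(g, m, B)\<in>I. bshift g -` Y m B)"
  proof (rule meager_UN)
    fix t assume "t \<in> I"
    then show "meager_in euclidean (case t of (g, m, B) \<Rightarrow> bshift g -` Y m B)"
      unfolding I_def using \<Gamma>_bij nd
      by (auto intro!: nowhere_dense_imp_meager nowhere_dense_vimage_bshift)
  qed
  then show ?thesis
  proof (rule meager_subset)
    show "{x \<in> C. \<not> range (f x) \<subseteq> T} \<subseteq> (\<Union>(g, m, B)\<in>I. bshift g -` Y m B)"
    proof
      fix x assume "x \<in> {x \<in> C. \<not> range (f x) \<subseteq> T}"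
      then obtain k where x: "x \<in> C" "f x k \<notin> T" by blast
      obtain g m B where g: "g \<in> \<Gamma>" "finite B" "acl P B \<subseteq> B" "bshift g x \<in> Z m B"
        "f (bshift g x) m = f x k"
        using finite_support[OF x(1), of k] by blast
      have "bshift g x \<in> Y m B" unfolding Y_def using g x(2) by simp
      then have "x \<in> (case (g, m, B) of (g, m, B) \<Rightarrow> bshift g -` Y m B)" by simp
      moreover have "(g, m, B) \<in> I" unfolding I_def using g by simp
      ultimately show "x \<in> (\<Union>(g, m, B)\<in>I. bshift g -` Y m B)" by (rule UN_I[rotated])
    qed
  qed
qed

text \<open>\<open>T\<close> is countable, so all finite patterns with nowhere dense realisation can
  be discarded; a pattern seen at one remaining point is then met by the orbit of every
  other.\<close>

lemma generic_single_class:
  "\<exists>C'\<subseteq>C. meager_in euclidean (- C') \<and> (\<forall>x\<in>C'. \<forall>y\<in>C'. \<exists>q\<in>Q. f y = bshift q (f x))"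
proof -
  obtain z where z: "z \<in> C" using C_dense[of UNIV] by auto
  have "T \<subseteq> range (f z)" using z unfolding T_def by blast
  then have T: "countable T" by (rule countable_subset) simp
  define M where "M ps ts = {x \<in> C. map (f x) ps = ts}" for ps ts
  define I where "I = {(ps, ts). ts \<in> lists T \<and> nowhere_dense_in euclidean (M ps ts)}"
  define C' where "C' = {x \<in> C. range (f x) \<subseteq> T} - (\<Union>(ps, ts)\<in>I. M ps ts)"
  have "countable (UNIV \<times> lists T :: (nat list \<times> real list) set)"
    using T by (intro countable_SIGMA) auto
  then have "countable I" by (rule countable_subset[rotated]) (auto simp: I_def)
  then have "meager_in euclidean (\<Union>(ps, ts)\<in>I. M ps ts)"
    by (rule meager_UN) (auto simp: I_def intro: nowhere_dense_imp_meager)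
  then have "meager_in euclidean (- C \<union> ({x \<in> C. \<not> range (f x) \<subseteq> T} \<union> (\<Union>(ps, ts)\<in>I. M ps ts)))"
    by (intro meager_Un C_comeager generic_range)
  then have C'_comeager: "meager_in euclidean (- C')"
    by (rule meager_subset) (unfold C'_def, blast)
  have "\<exists>q\<in>Q. f y = bshift q (f x)" if x: "x \<in> C'" and y: "y \<in> C'" for x y
  proof -
    have C: "x \<in> C" "y \<in> C" using x y by (auto simp: C'_def)
    have rng: "range (f x) = T" "range (f y) = T" using x y unfolding C'_def T_def by blast+
    \<comment> \<open>Both points list exactly \<open>T\<close>, without repetition, so matching
      equal reals is a bijection of positions; it remains to approximate it by elements of
      \<open>Q\<close>.\<close>
    define q where "q k = inv (f y) (f x k)" for k
    have fq: "f y (q k) = f x k" for k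
      unfolding q_def by (rule f_inv_into_f) (use rng in auto)
    have bq: "bij q"
    proof (rule bijI)
      show "inj q" by (rule injI) (metis fq inj_f injD)
      show "surj q"
      proof (rule surjI)
        fix b
        have "f x (inv (f x) (f y b)) = f y b" by (rule f_inv_into_f) (use rng in auto)
        then show "q (inv (f x) (f y b)) = b" unfolding q_def using inj_f by simp
      qed
    qed
    have "q \<in> Q"
    proof (rule pgroup_closed[OF Q bq])
      fix N
      define ps where "ps = map q [0..<N]"
      define ts where "ts = map (f x) [0..<N]"
      have "y \<in> M ps ts" using C(2) unfolding M_def ps_def ts_def by (simp add: fq)
      moreover have "ts \<in> lists T" unfolding ts_def using rng(1) by (auto simp: lists_eq_set)
      ultimately have "\<not> nowhere_dense_in euclidean (M ps ts)"
        using y unfolding C'_def I_def by blast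
      then obtain U where U: "open U" "U \<noteq> {}"
        "\<And>V. V \<subseteq> U \<Longrightarrow> open V \<Longrightarrow> V \<noteq> {} \<Longrightarrow> V \<inter> M ps ts \<noteq> {}"
        unfolding nowhere_dense_iff by meson
      \<comment> \<open>Once \<open>x\<close> is shifted to where the pattern of \<open>y\<close> is
        dense, continuity makes the pattern hold exactly, so the element of \<open>Q\<close> given
        by \<open>hom\<close> agrees with \<open>q\<close> below \<open>N\<close>.\<close>
      obtain h where h: "h \<in> \<Gamma>" "bshift h x \<in> U" using dense_orbit[OF C(1) U(1,2)] by blast
      have hx: "bshift h x \<in> U \<inter> C" using h C_inv C(1) by blast
      have eq: "f (bshift h x) (q k) = f x k" if k: "k < N" for k
      proof (rule eq_on_dense[OF cont continuous_on_const U(1) _ hx])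
        fix V assume "V \<subseteq> U" "open V" "V \<noteq> {}"
        then obtain w where w: "w \<in> V" "w \<in> C" "map (f w) ps = ts"
          using U(3) unfolding M_def by blast
        then have "f w (q k) = f x k" using k by (auto simp: ps_def ts_def)
        then show "\<exists>w\<in>V \<inter> C. f w (q k) = f x k" using w by blast
      qed
      obtain r where r: "r \<in> Q" "f (bshift h x) = bshift r (f x)" using hom h(1) \<Gamma>_sub by blast
      have "r k = q k" if "k < N" for k
      proof -
        have "bshift r (f x) (q k) = f x k" using eq[OF that] unfolding r(2) .
        then have "f x (inv r (q k)) = f x k" unfolding bshift_def .
        then have "inv r (q k) = k" using inj_f by (meson injD)
        then show ?thesis using pgroup(1)[OF Q r(1)] by (metis bij_inv_eq_iff)
      qed
      then show "\<exists>r\<in>Q. \<forall>k<N. r k = q k" using r(1) by blast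
    qed
    moreover have "f y = bshift q (f x)"
    proof
      fix b
      have "f y (q (inv q b)) = f x (inv q b)" by (rule fq)
      then show "f y b = bshift q (f x) b"
        unfolding bshift_def using bq by (simp add: bij_is_surj surj_f_inv_f)
    qed
    ultimately show ?thesis by blast
  qed
  moreover have "C' \<subseteq> C" unfolding C'_def by blast
  ultimately show ?thesis using C'_comeager by blast
qed

end

section \<open>Existence of generic points\<close>

lemma nowhere_dense_Compl:
  fixes W :: "'a::topological_space set"
  assumes "open W" "\<And>U. open U \<Longrightarrow> U \<noteq> {} \<Longrightarrow> U \<inter> W \<noteq> {}"
  shows "nowhere_dense_in euclidean (- W)"
  unfolding nowhere_dense_iff
proof (intro allI impI)
  fix U :: "'a set" assume "open U" "U \<noteq> {}"
  then show "\<exists>V\<subseteq>U. open V \<and> V \<noteq> {} \<and> V \<inter> - W = {}"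
    using assms by (intro exI[of _ "U \<inter> W"]) auto
qed

text \<open>One element is chosen for each finite partial map realised in \<open>P\<close>; words in
  these and their inverses are countably many.\<close>

lemma countable_dense_subgroup:
  assumes P: "polish_perm_group P"
  obtains \<Gamma> where "\<Gamma> \<subseteq> P" "countable \<Gamma>" "id \<in> \<Gamma>" "\<And>g h. g \<in> \<Gamma> \<Longrightarrow> h \<in> \<Gamma> \<Longrightarrow> g \<circ> h \<in> \<Gamma>"
    "\<And>g. g \<in> \<Gamma> \<Longrightarrow> inv g \<in> \<Gamma>" "\<And>g F. g \<in> P \<Longrightarrow> finite F \<Longrightarrow> \<exists>h\<in>\<Gamma>. \<forall>a\<in>F. h a = g a"
proof -
  define pick where "pick s t = (SOME g. g \<in> P \<and> map g s = t)" for s t :: "nat list"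
  have pick: "pick s (map g s) \<in> P" "map (pick s (map g s)) s = map g s" if "g \<in> P" for g s
  proof -
    have "pick s (map g s) \<in> P \<and> map (pick s (map g s)) s = map g s"
      unfolding pick_def by (rule someI[where x = g]) (use that in simp)
    then show "pick s (map g s) \<in> P" "map (pick s (map g s)) s = map g s" by auto
  qed
  \<comment> \<open>\<open>SOME\<close> is arbitrary for pairs not realised in \<open>P\<close>; the
    intersection discards such choices outside \<open>P\<close>.\<close>
  define D0 where "D0 = P \<inter> range (\<lambda>(s, t). pick s t)"
  define D where "D = D0 \<union> inv ` D0"
  have DP: "D \<subseteq> P" unfolding D_def D0_def using pgroup(4)[OF P] by auto
  have Dinv: "inv g \<in> D" if g: "g \<in> D" for g
  proof (cases "g \<in> D0")
    case False
    then obtain h where h: "h \<in> D0" "g = inv h" using g unfolding D_def by blast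
    then have "inv g = h" using pgroup(1)[OF P, of h] unfolding D0_def by (simp add: inv_inv_eq)
    then show ?thesis using h unfolding D_def by simp
  next
    case True
    then show ?thesis unfolding D_def by blast
  qed
  have "countable D" unfolding D_def D0_def by auto
  define c where "c l = foldr (\<circ>) l id" for l :: "(nat \<Rightarrow> nat) list"
  have c_simps: "c [] = id" "c (g # l) = g \<circ> c l" for g l by (auto simp: c_def)
  have c_append: "c (l @ l') = c l \<circ> c l'" for l l'
    by (induction l) (auto simp: c_simps comp_assoc)
  have c_P: "c l \<in> P" if "l \<in> lists D" for l
    using that
  proof (induction l)
    case Nil
    show ?case unfolding c_simps by (rule pgroup(2)[OF P])
  next
    case (Cons g l)
    show ?case unfolding c_simps using Cons DP by (intro pgroup(3)[OF P]) auto
  qed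
  define \<Gamma> where "\<Gamma> = c ` lists D"
  have c_inv: "inv (c l) \<in> \<Gamma>" if "l \<in> lists D" for l
    using that
  proof (induction l)
    case Nil
    have "c [] \<in> \<Gamma>" unfolding \<Gamma>_def by blast
    then show ?case by (simp only: c_simps inv_id)
  next
    case (Cons g l)
    then obtain l' where l': "inv (c l) = c l'" "l' \<in> lists D" unfolding \<Gamma>_def by blast
    have "bij g" "bij (c l)" using Cons DP c_P pgroup(1)[OF P] by auto
    then have "inv (c (g # l)) = c l' \<circ> inv g" by (simp add: c_simps o_inv_distrib l'(1))
    also have "\<dots> = c (l' @ [inv g])" by (simp add: c_append c_simps)
    also have "\<dots> \<in> \<Gamma>" unfolding \<Gamma>_def using l'(2) Cons Dinv by (intro imageI) auto
    finally show ?case .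
  qed
  show thesis
  proof (rule that)
    show "\<Gamma> \<subseteq> P" unfolding \<Gamma>_def using c_P by blast
    show "countable \<Gamma>" unfolding \<Gamma>_def using \<open>countable D\<close> by simp
    have "c [] \<in> \<Gamma>" unfolding \<Gamma>_def by blast
    then show "id \<in> \<Gamma>" by (simp only: c_simps)
    show "g \<circ> h \<in> \<Gamma>" if gh: "g \<in> \<Gamma>" "h \<in> \<Gamma>" for g h
    proof -
      obtain l l' where l: "g = c l" "l \<in> lists D" "h = c l'" "l' \<in> lists D"
        using gh unfolding \<Gamma>_def by blast
      have "c (l @ l') \<in> \<Gamma>" unfolding \<Gamma>_def using l by (intro imageI) auto
      then show ?thesis by (simp add: l c_append)
    qed
    show "inv g \<in> \<Gamma>" if "g \<in> \<Gamma>" for g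
    proof -
      obtain l where l: "g = c l" "l \<in> lists D" using \<open>g \<in> \<Gamma>\<close> unfolding \<Gamma>_def by blast
      then show ?thesis using c_inv by simp
    qed
    show "\<exists>h\<in>\<Gamma>. \<forall>a\<in>F. h a = g a" if g: "g \<in> P" and F: "finite F" for g and F :: "nat set"
    proof -
      obtain s where s: "set s = F" using finite_list[OF F] by blast
      let ?h = "pick s (map g s)"
      have "?h \<in> D" unfolding D_def D0_def using pick(1)[OF g] by auto
      then have "c [?h] \<in> \<Gamma>" unfolding \<Gamma>_def by (intro imageI) auto
      then have "?h \<in> \<Gamma>" by (simp add: c_simps)
      moreover have "\<forall>a\<in>F. ?h a = g a" using pick(2)[OF g, of s] s by (simp add: map_eq_conv)
      ultimately show ?thesis by blast
    qed
  qed
qed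

text \<open>Splits density of stabiliser orbits in fibres into countably many open conditions:
  rational targets \<open>l\<close> outside \<open>B\<close>, with tolerance
  \<open>1 / real (Suc k)\<close>.\<close>

definition hits :: "(nat \<Rightarrow> nat) set \<Rightarrow> nat set \<Rightarrow> rat list \<Rightarrow> nat \<Rightarrow> (nat \<Rightarrow> real) set" where
  "hits G B l k = (\<Union>h\<in>{h \<in> G. \<forall>b\<in>B. h b = b}.
     bshift h -` near ({..<length l} - B) (1 / real (Suc k)) (\<lambda>a. of_rat (l ! a)))"

lemma open_hits: "open (hits G B l k)"
  unfolding hits_def by (intro open_UN ballI open_vimage_bshift open_near) simp

lemma hits_dense:
  assumes P: "polish_perm_group P" and B: "finite B" "acl P B \<subseteq> B"
    and inv: "\<And>g. g \<in> \<Gamma> \<Longrightarrow> inv g \<in> \<Gamma>" and sub: "\<Gamma> \<subseteq> P"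
    and dense: "\<And>g F. g \<in> P \<Longrightarrow> finite F \<Longrightarrow> \<exists>h\<in>\<Gamma>. \<forall>a\<in>F. h a = g a"
    and U: "open U" "U \<noteq> {}"
  shows "U \<inter> hits \<Gamma> B l k \<noteq> {}"
proof -
  obtain y where y: "y \<in> U" using U by blast
  obtain N e where N: "e > 0" "near {..<N} e y \<subseteq> U" by (rule open_contains_near[OF U(1) y])
  define F where "F = {..<length l} - B"
  \<comment> \<open>Coordinates outside the closed set \<open>B\<close> have infinite orbits, so
    Neumann's lemma moves \<open>F\<close> beyond the box, where the target values can be prescribed
    freely.\<close>
  have "\<exists>g\<in>pstab P B. g ` F \<inter> {..<N} = {}"
  proof (rule neumann)
    show "infinite ((\<lambda>g. g a) ` pstab P B)" if "a \<in> F" for a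
    proof -
      have "a \<notin> acl P B" using that B(2) unfolding F_def by blast
      then show ?thesis unfolding acl_def by simp
    qed
  qed (use pstab_group[OF P] in \<open>auto simp: F_def\<close>)
  then obtain g where g: "g \<in> pstab P B" "g ` F \<inter> {..<N} = {}" by blast
  obtain h where h: "h \<in> \<Gamma>" "\<forall>a\<in>F \<union> B. h a = g a"
    using dense[of g "F \<union> B"] g(1) B(1) unfolding pstab_def F_def by auto
  have bh: "bij h" using h(1) sub pgroup(1)[OF P] by blast
  have h_fix: "h b = b" if "b \<in> B" for b using h(2) g(1) that by (simp add: pstab_def)
  have hF: "\<not> h a < N" if "a \<in> F" for a using h(2) g(2) that by auto
  define x where "x c = (if c < N then y c else of_rat (l ! (inv h c)))" for c
  have "x \<in> U" using N(1) by (intro subsetD[OF N(2)]) (simp add: near_def x_def)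
  moreover have "bshift (inv h) x a = of_rat (l ! a)" if "a \<in> F" for a
    using hF[OF that] bh by (simp add: bshift_inv x_def bij_is_inj)
  then have "bshift (inv h) x \<in> near F (1 / real (Suc k)) (\<lambda>a. of_rat (l ! a))"
    by (simp add: near_def)
  moreover have "inv h b = b" if "b \<in> B" for b
    using h_fix[OF that] bh by (metis bij_inv_eq_iff)
  ultimately have "x \<in> U \<inter> hits \<Gamma> B l k" unfolding hits_def F_def using inv[OF h(1)] by blast
  then show ?thesis by blast
qed

text \<open>Rational approximation handles the coordinates outside \<open>B\<close>; on
  \<open>B\<close> the shifted point still equals \<open>y\<close>.\<close>

lemma fibre_of_hits:
  assumes x: "\<And>l k. x \<in> hits \<Gamma> B l k" and bij: "\<And>g. g \<in> \<Gamma> \<Longrightarrow> bij g"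
    and U: "open U" "y \<in> U" and eq: "\<And>b. b \<in> B \<Longrightarrow> y b = x b"
  shows "\<exists>h\<in>\<Gamma>. (\<forall>b\<in>B. h b = b) \<and> bshift h x \<in> U"
proof -
  obtain N e where N: "e > 0" "near {..<N} e y \<subseteq> U" by (rule open_contains_near[OF U])
  obtain k where k: "1 / real (Suc k) < e / 2" using N(1) nat_approx_posE[of "e / 2"] by auto
  have "\<exists>r. \<bar>of_rat r - y a\<bar> < e / 2" for a
  proof -
    obtain r where "y a - e / 2 < of_rat r" "of_rat r < y a + e / 2"
      using of_rat_dense[of "y a - e / 2" "y a + e / 2"] N(1) by auto
    then have "\<bar>of_rat r - y a\<bar> < e / 2" unfolding abs_less_iff by linarith
    then show ?thesis by blast
  qed
  then obtain r where r: "\<And>a. \<bar>of_rat (r a) - y a\<bar> < e / 2" by metis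
  obtain h where h: "h \<in> \<Gamma>" "\<forall>b\<in>B. h b = b"
    "bshift h x \<in> near ({..<N} - B) (1 / real (Suc k)) (\<lambda>a. of_rat (map r [0..<N] ! a))"
    using x[of "map r [0..<N]" k] unfolding hits_def by auto
  have "\<bar>bshift h x a - y a\<bar> < e" if a: "a < N" for a
  proof (cases "a \<in> B")
    case True
    then have "inv h a = a" using h(2) bij[OF h(1)] by (metis bij_inv_eq_iff)
    then show ?thesis using eq[OF True] N(1) by (simp add: bshift_def)
  next
    case False
    then have "\<bar>bshift h x a - of_rat (r a)\<bar> < 1 / real (Suc k)"
      using h(3) a by (auto simp: near_def)
    then show ?thesis using k r[of a] by linarith
  qed
  then have "bshift h x \<in> U" by (intro subsetD[OF N(2)]) (simp add: near_def)
  then show ?thesis using h by blast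
qed

text \<open>Complements of closures avoid \<open>M\<close> and are open, and the \<open>hits\<close>
  sets are dense by Neumann's lemma; intersecting all their \<open>\<Gamma>\<close>-translates gives
  invariance.\<close>

lemma exists_generic_set:
  assumes P: "polish_perm_group P" and sub: "\<Gamma> \<subseteq> P" and id: "id \<in> \<Gamma>" and count: "countable \<Gamma>"
    and comp: "\<And>g h. g \<in> \<Gamma> \<Longrightarrow> h \<in> \<Gamma> \<Longrightarrow> g \<circ> h \<in> \<Gamma>"
    and inv: "\<And>g. g \<in> \<Gamma> \<Longrightarrow> inv g \<in> \<Gamma>"
    and dense: "\<And>g F. g \<in> P \<Longrightarrow> finite F \<Longrightarrow> \<exists>h\<in>\<Gamma>. \<forall>a\<in>F. h a = g a"
    and M: "meager_in euclidean M"
  obtains C where "C \<inter> M = {}"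
    "\<exists>W :: nat \<Rightarrow> (nat \<Rightarrow> real) set. (\<forall>i. open (W i)) \<and> C = (\<Inter>i. W i)"
    "meager_in euclidean (- C)" "\<And>x g. x \<in> C \<Longrightarrow> g \<in> \<Gamma> \<Longrightarrow> bshift g x \<in> C"
    "\<And>x B l k. x \<in> C \<Longrightarrow> finite B \<Longrightarrow> acl P B \<subseteq> B \<Longrightarrow> x \<in> hits \<Gamma> B l k"
proof -
  have bij: "bij g" if "g \<in> \<Gamma>" for g using pgroup(1)[OF P] sub that by blast
  obtain F where F: "countable F" "\<And>S. S \<in> F \<Longrightarrow> nowhere_dense_in euclidean S" "M \<subseteq> \<Union>F"
    using M unfolding meager_in_def by blast
  define I where "I = {B. finite (B :: nat set) \<and> acl P B \<subseteq> B} \<times> (UNIV :: rat list set) \<times> (UNIV :: nat set)"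
  define \<W> where "\<W> = (\<lambda>S. - closure S) ` F \<union> (\<lambda>(B, l, k). hits \<Gamma> B l k) ` I"
  have "countable {B. finite (B :: nat set) \<and> acl P B \<subseteq> B}"
    by (rule countable_subset[OF _ countable_Collect_finite]) auto
  then have \<W>_count: "countable \<W>" unfolding \<W>_def I_def using F(1) by auto
  have \<W>_open: "open W" if "W \<in> \<W>" for W
    using that unfolding \<W>_def by (auto simp: open_hits)
  have \<W>_nd: "nowhere_dense_in euclidean (- W)" if W: "W \<in> \<W>" for W
  proof (rule nowhere_dense_Compl[OF \<W>_open[OF W]])
    fix U :: "(nat \<Rightarrow> real) set" assume U: "open U" "U \<noteq> {}"
    from W consider (nd) S where "S \<in> F" "W = - closure S"
      | (hits) B l k where "finite B" "acl P B \<subseteq> B" "W = hits \<Gamma> B l k"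
      unfolding \<W>_def I_def by auto
    then show "U \<inter> W \<noteq> {}"
    proof cases
      case nd
      then have "interior (closure S) = {}" using F(2) by (simp add: nowhere_dense_in_def)
      then have "\<not> U \<subseteq> closure S" using U interior_maximal[of U "closure S"] by auto
      then show ?thesis using nd by blast
    next
      case hits
      then show ?thesis using hits_dense[OF P _ _ inv sub dense U] by simp
    qed
  qed
  \<comment> \<open>\<open>UNIV\<close> keeps the family nonempty, so that
    \<open>from_nat_into\<close> enumerates exactly it.\<close>
  define \<V> where "\<V> = (\<lambda>(g, W). bshift g -` W) ` (\<Gamma> \<times> insert UNIV \<W>)"
  have \<V>: "countable \<V>" "\<V> \<noteq> {}"
    unfolding \<V>_def using count \<W>_count id by auto
  have \<V>_cases: "\<exists>g\<in>\<Gamma>. \<exists>W\<in>insert UNIV \<W>. V = bshift g -` W" if V: "V \<in> \<V>" for V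
  proof -
    obtain t where "t \<in> \<Gamma> \<times> insert UNIV \<W>" "V = (case t of (g, W) \<Rightarrow> bshift g -` W)"
      using V unfolding \<V>_def by (rule imageE)
    then show ?thesis by (cases t) (simp del: insert_iff, blast)
  qed
  define C where "C = \<Inter>\<V>"
  have CW: "x \<in> C \<Longrightarrow> g \<in> \<Gamma> \<Longrightarrow> W \<in> \<W> \<Longrightarrow> bshift g x \<in> W" for x g W
    unfolding C_def \<V>_def by auto
  have CW0: "x \<in> C \<Longrightarrow> W \<in> \<W> \<Longrightarrow> x \<in> W" for x W
    using CW[OF _ id] by simp
  show thesis
  proof (rule that)
    have "x \<notin> S" if "x \<in> C" "S \<in> F" for x S
      using CW0[OF that(1), of "- closure S"] that(2) closure_subset[of S] unfolding \<W>_def by blast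
    then show "C \<inter> M = {}" using F(3) by blast
    have "open V" if "V \<in> \<V>" for V
      using \<V>_cases[OF that] \<W>_open open_vimage_bshift by auto
    moreover have "range (from_nat_into \<V>) = \<V>" using \<V> by (rule range_from_nat_into[rotated])
    ultimately show "\<exists>W :: nat \<Rightarrow> (nat \<Rightarrow> real) set. (\<forall>i. open (W i)) \<and> C = (\<Inter>i. W i)"
      unfolding C_def by (intro exI[of _ "from_nat_into \<V>"]) (metis from_nat_into \<V>(2))
    have "meager_in euclidean (- V)" if V: "V \<in> \<V>" for V
    proof -
      obtain g W where g: "g \<in> \<Gamma>" "W \<in> insert UNIV \<W>" "V = bshift g -` W"
        using \<V>_cases[OF V] by blast
      have "nowhere_dense_in euclidean (- W)"
        using g(2) \<W>_nd by (auto simp: nowhere_dense_in_def)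
      from nowhere_dense_vimage_bshift[OF this bij[OF g(1)]] show ?thesis
        unfolding g(3) vimage_Compl by (rule nowhere_dense_imp_meager)
    qed
    then have "meager_in euclidean (\<Union>V\<in>\<V>. - V)" by (rule meager_UN[OF \<V>(1)])
    then show "meager_in euclidean (- C)" by (rule meager_subset) (auto simp: C_def)
    show "bshift g x \<in> C" if x: "x \<in> C" "g \<in> \<Gamma>" for x g
      unfolding C_def
    proof
      fix V assume "V \<in> \<V>"
      then obtain h W where h: "h \<in> \<Gamma>" "W \<in> insert UNIV \<W>" "V = bshift h -` W"
        using \<V>_cases by blast
      have "bshift (h \<circ> g) x \<in> W" using CW[OF x(1) comp[OF h(1) x(2)]] h(2) by auto
      then show "bshift g x \<in> V" using h(3) bshift_comp[OF bij[OF h(1)] bij[OF x(2)]] by simp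
    qed
    show "x \<in> hits \<Gamma> B l k" if "x \<in> C" "finite B" "acl P B \<subseteq> B" for x B l k
    proof (rule CW0[OF that(1)])
      have "(B, l, k) \<in> I" unfolding I_def using that by simp
      then have "(case (B, l, k) of (B, l, k) \<Rightarrow> hits \<Gamma> B l k) \<in> \<W>"
        unfolding \<W>_def by (intro UnI2 imageI)
      then show "hits \<Gamma> B l k \<in> \<W>" by simp
    qed
  qed
qed

text \<open>Off one meager set, preimages of basic open sets under each coordinate coincide with
  open sets; countability of the basis and of the coordinates keeps the exceptional set
  meager.\<close>

lemma baire_measurable_continuous:
  fixes f :: "'a::topological_space \<Rightarrow> nat \<Rightarrow> real"
  assumes f: "baire_measurable euclidean (top_of_set S) f"
  obtains M where "meager_in euclidean M" "\<And>C k. C \<inter> M = {} \<Longrightarrow> continuous_on C (\<lambda>x. f x k)"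
proof -
  obtain \<B> :: "real set set" where \<B>: "countable \<B>" "topological_basis \<B>"
    using ex_countable_basis by blast
  have fS: "f x \<in> S" for x using f unfolding baire_measurable_def by auto
  have ex: "\<exists>V. open V \<and> meager_in euclidean (({x. f x k \<in> b} - V) \<union> (V - {x. f x k \<in> b}))"
    if b: "b \<in> \<B>" for k b
  proof -
    have "open b" using \<B>(2) b by (rule topological_basis_open)
    then have "open {y :: nat \<Rightarrow> real. y k \<in> b}"
      using product_topology_basis'[of "{k}" "\<lambda>_. b" id] by simp
    then have "openin (top_of_set S) (S \<inter> {y. y k \<in> b})" by (rule openin_open_Int)
    then have "baire_property_in euclidean {x \<in> topspace euclidean. f x \<in> S \<inter> {y. y k \<in> b}}"
      using f unfolding baire_measurable_def by blast
    then show ?thesis using fS unfolding baire_property_in_def by simp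
  qed
  define V where "V k b = (SOME V. open V \<and>
    meager_in euclidean (({x. f x k \<in> b} - V) \<union> (V - {x. f x k \<in> b})))" for k b
  have V: "open (V k b) \<and> meager_in euclidean (({x. f x k \<in> b} - V k b) \<union> (V k b - {x. f x k \<in> b}))"
    if "b \<in> \<B>" for k b
    unfolding V_def by (rule someI_ex) (rule ex[OF that])
  define M where "M = (\<Union>t\<in>UNIV \<times> \<B>. ({x. f x (fst t) \<in> snd t} - V (fst t) (snd t)) \<union>
    (V (fst t) (snd t) - {x. f x (fst t) \<in> snd t}))"
  have "meager_in euclidean M"
    unfolding M_def by (rule meager_UN) (use \<B>(1) V in auto)
  moreover have "continuous_on C (\<lambda>x. f x k)" if C: "C \<inter> M = {}" for C k
    unfolding continuous_on_topological
  proof (intro ballI allI impI)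
    fix x B assume x: "x \<in> C" and B: "open B" "f x k \<in> B"
    obtain b where b: "b \<in> \<B>" "f x k \<in> b" "b \<subseteq> B" using topological_basisE[OF \<B>(2) B] by blast
    have iff: "y \<in> V k b \<longleftrightarrow> f y k \<in> b" if "y \<in> C" for y
    proof -
      have "y \<notin> M" using that C by blast
      then show ?thesis unfolding M_def using b(1) by auto
    qed
    show "\<exists>A. open A \<and> x \<in> A \<and> (\<forall>y\<in>C. y \<in> A \<longrightarrow> f y k \<in> B)"
      using V[OF b(1), of k] iff b x by blast
  qed
  ultimately show thesis by (rule that)
qed

section \<open>Dimension bounds and generic ergodicity\<close>

lemma alg_dim_prop_Suc:
  assumes "alg_dim_prop Q m"
  shows "alg_dim_prop Q (Suc m)"
  unfolding alg_dim_prop_def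
proof (intro allI impI)
  fix A :: "nat set" assume A: "card A = Suc (Suc m)"
  then obtain a0 where a0: "a0 \<in> A" by fastforce
  have "card (A - {a0}) = Suc m" using A a0 by simp
  then obtain a where a: "a \<in> A - {a0}" "a \<in> acl Q (A - {a0} - {a})"
    using assms unfolding alg_dim_prop_def by blast
  have "acl Q (A - {a0} - {a}) \<subseteq> acl Q (A - {a})" by (rule acl_mono) blast
  then show "\<exists>a\<in>A. a \<in> acl Q (A - {a})" using a by blast
qed

text \<open>The dimension is a least witness, so the property is carried upward from it to
  \<open>n\<close>.\<close>

lemma alg_dim_le:
  assumes "alg_dim Q \<le> enat n"
  shows "alg_dim_prop Q n"
proof -
  have ex: "\<exists>m. alg_dim_prop Q m"
  proof (rule ccontr)
    assume "\<not> ?thesis"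
    then show False using assms by (simp add: alg_dim_def)
  qed
  then have le: "(LEAST m. alg_dim_prop Q m) \<le> n" using assms by (simp add: alg_dim_def)
  have "alg_dim_prop Q (LEAST m. alg_dim_prop Q m)" using ex by (rule LeastI_ex)
  with le show ?thesis
    by (induction rule: dec_induct) (auto intro: alg_dim_prop_Suc)
qed

lemma generically_ergodic_bernoulli:
  assumes P: "polish_perm_group P" and Q: "polish_perm_group Q"
    and dim: "alg_dim Q \<le> enat n" and lf: "locally_finite_pg P" and free: "n_free (Suc n) P"
  shows "generically_ergodic (euclidean :: (nat \<Rightarrow> real) topology) (bernoulli_eq P)
    (top_of_set inj_seqs) (bernoulli_eq_inj Q)"
  unfolding generically_ergodic_def
proof (intro allI impI)
  fix f :: "(nat \<Rightarrow> real) \<Rightarrow> nat \<Rightarrow> real"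
  assume "baire_measurable euclidean (top_of_set inj_seqs) f \<and>
    (\<forall>x\<in>topspace euclidean. \<forall>x'\<in>topspace euclidean.
      (x, x') \<in> bernoulli_eq P \<longrightarrow> (f x, f x') \<in> bernoulli_eq_inj Q)"
  then have f: "baire_measurable euclidean (top_of_set inj_seqs) f"
    and hom: "\<And>x x'. (x, x') \<in> bernoulli_eq P \<Longrightarrow> (f x, f x') \<in> bernoulli_eq_inj Q" by auto
  have f_inj: "f x \<in> inj_seqs" for x using f unfolding baire_measurable_def by auto
  obtain M where M: "meager_in euclidean M" "\<And>C k. C \<inter> M = {} \<Longrightarrow> continuous_on C (\<lambda>x. f x k)"
    using baire_measurable_continuous[OF f] by blast
  obtain \<Gamma> where \<Gamma>: "\<Gamma> \<subseteq> P" "countable \<Gamma>" "id \<in> \<Gamma>"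
    "\<And>g h. g \<in> \<Gamma> \<Longrightarrow> h \<in> \<Gamma> \<Longrightarrow> g \<circ> h \<in> \<Gamma>" "\<And>g. g \<in> \<Gamma> \<Longrightarrow> inv g \<in> \<Gamma>"
    "\<And>g F. g \<in> P \<Longrightarrow> finite F \<Longrightarrow> \<exists>h\<in>\<Gamma>. \<forall>a\<in>F. h a = g a"
    using countable_dense_subgroup[OF P] by blast
  obtain C where C: "C \<inter> M = {}"
    "\<exists>W :: nat \<Rightarrow> (nat \<Rightarrow> real) set. (\<forall>i. open (W i)) \<and> C = (\<Inter>i. W i)"
    "meager_in euclidean (- C)" "\<And>x g. x \<in> C \<Longrightarrow> g \<in> \<Gamma> \<Longrightarrow> bshift g x \<in> C"
    "\<And>x B l k. x \<in> C \<Longrightarrow> finite B \<Longrightarrow> acl P B \<subseteq> B \<Longrightarrow> x \<in> hits \<Gamma> B l k"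
    using exists_generic_set[OF P \<Gamma>(1,3,2,4,5,6) M(1)] by blast
  interpret shift_hom P Q \<Gamma> C f n
  proof
    show "inj (f x)" for x using f_inj by (simp add: inj_seqs_def)
    show "\<exists>q\<in>Q. f (bshift g x) = bshift q (f x)" if "g \<in> P" for g x
      using hom[of x "bshift g x"] that unfolding bernoulli_eq_inj_def bernoulli_eq_def by blast
    show "\<exists>h\<in>\<Gamma>. (\<forall>b\<in>B. h b = b) \<and> bshift h x \<in> U"
      if "x \<in> C" "finite B" "acl P B \<subseteq> B" "open U" "y \<in> U" "\<And>b. b \<in> B \<Longrightarrow> y b = x b"
      for x B U y
      by (rule fibre_of_hits[OF C(5)[OF that(1-3)] _ that(4-6)]) (use pgroup(1)[OF P] \<Gamma>(1) in blast)
  qed (fact P Q lf free alg_dim_le[OF dim] \<Gamma> C(2,3,4) M(2)[OF C(1)])+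
  obtain C' where C': "meager_in euclidean (- C')"
    "\<And>x y. x \<in> C' \<Longrightarrow> y \<in> C' \<Longrightarrow> \<exists>q\<in>Q. f y = bshift q (f x)"
    using generic_single_class by blast
  have "C' \<noteq> {}" using C'(1) open_not_meager[of "UNIV :: (nat \<Rightarrow> real) set"] by auto
  then obtain z where z: "z \<in> C'" by blast
  have "comeager_in euclidean C'"
    using C'(1) by (simp add: comeager_in_def Compl_eq_Diff_UNIV)
  moreover have "(f x, f z) \<in> bernoulli_eq_inj Q" if "x \<in> C'" for x
    using C'(2)[OF that z] f_inj unfolding bernoulli_eq_inj_def bernoulli_eq_def by blast
  ultimately show "\<exists>C. comeager_in euclidean C \<and>
      (\<exists>y\<in>topspace (top_of_set inj_seqs). \<forall>x\<in>C. (f x, y) \<in> bernoulli_eq_inj Q)"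
    using f_inj by auto
qed

section \<open>Borel irreducibility\<close>

lemma borel_baire_property:
  fixes S :: "'a::topological_space set"
  assumes "S \<in> sets borel"
  shows "baire_property_in euclidean S"
proof -
  have "S \<in> sigma_sets UNIV {S. open S}" using assms by (simp add: borel_def)
  then show ?thesis
  proof induction
    case (Basic U)
    then show ?case unfolding baire_property_in_def
      by (intro exI[of _ U]) (auto simp: meager_in_def)
  next
    case Empty
    show ?case unfolding baire_property_in_def
      by (intro exI[of _ "{}"]) (auto simp: meager_in_def)
  next
    case (Compl S)
    then obtain U where U: "open U" "meager_in euclidean ((S - U) \<union> (U - S))"
      unfolding baire_property_in_def by auto
    \<comment> \<open>\<open>- U\<close> is only closed; passing to its interior costs a nowhere
      dense boundary.\<close>
    have "nowhere_dense_in euclidean (- U - interior (- U))"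
      unfolding nowhere_dense_iff
    proof (intro allI impI)
      fix V :: "'a set" assume V: "open V" "V \<noteq> {}"
      show "\<exists>V'\<subseteq>V. open V' \<and> V' \<noteq> {} \<and> V' \<inter> (- U - interior (- U)) = {}"
      proof (cases "V \<inter> U = {}")
        case True
        then have "V \<subseteq> interior (- U)" using V by (intro interior_maximal) auto
        then show ?thesis using V by blast
      next
        case False
        then show ?thesis using V U(1) by (intro exI[of _ "V \<inter> U"]) auto
      qed
    qed
    then have "meager_in euclidean (((S - U) \<union> (U - S)) \<union> (- U - interior (- U)))"
      by (intro meager_Un U nowhere_dense_imp_meager)
    moreover have "((UNIV - S) - interior (- U)) \<union> (interior (- U) - (UNIV - S)) \<subseteq>
        ((S - U) \<union> (U - S)) \<union> (- U - interior (- U))"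
      using interior_subset[of "- U"] by blast
    ultimately have "meager_in euclidean (((UNIV - S) - interior (- U)) \<union> (interior (- U) - (UNIV - S)))"
      by (rule meager_subset)
    then show ?case unfolding baire_property_in_def by (intro exI[of _ "interior (- U)"]) auto
  next
    case (Union S)
    then obtain U where U: "\<And>i::nat. open (U i)"
      "\<And>i. meager_in euclidean ((S i - U i) \<union> (U i - S i))"
      unfolding baire_property_in_def by (metis open_openin)
    have "meager_in euclidean (\<Union>i\<in>UNIV. (S i - U i) \<union> (U i - S i))"
      by (rule meager_UN) (use U in auto)
    then have "meager_in euclidean (((\<Union>i. S i) - (\<Union>i. U i)) \<union> ((\<Union>i. U i) - (\<Union>i. S i)))"
      by (rule meager_subset) blast
    then show ?case unfolding baire_property_in_def using U(1)
      by (intro exI[of _ "\<Union>i. U i"]) auto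
  qed
qed

lemma borel_imp_baire_measurable:
  assumes f: "f \<in> borel_measurable borel" and S: "\<And>x. f x \<in> S"
  shows "baire_measurable euclidean (top_of_set S) f"
  unfolding baire_measurable_def
proof (intro conjI allI impI)
  show "f \<in> topspace euclidean \<rightarrow> topspace (top_of_set S)" using S by auto
  fix U assume "openin (top_of_set S) U"
  then obtain V where V: "open V" "U = S \<inter> V" unfolding openin_open by blast
  have "f -` V \<inter> space borel \<in> sets borel" using f by (rule measurable_sets) (rule borel_open[OF V(1)])
  moreover have "f -` V \<inter> space borel = {x \<in> topspace euclidean. f x \<in> U}" using V(2) S by auto
  ultimately show "baire_property_in euclidean {x \<in> topspace euclidean. f x \<in> U}"
    using borel_baire_property by simp
qed

lemma meager_coordinate:
  assumes "countable R"
  shows "meager_in euclidean {x :: nat \<Rightarrow> real. x a \<in> R}"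
proof -
  have "nowhere_dense_in euclidean (- {x :: nat \<Rightarrow> real. x a \<noteq> r})" for r
  proof (rule nowhere_dense_Compl)
    have "open {x :: nat \<Rightarrow> real. \<forall>i\<in>{a}. x (id i) \<in> - {r}}"
      by (rule product_topology_basis') auto
    then show "open {x :: nat \<Rightarrow> real. x a \<noteq> r}" by simp
    fix U :: "(nat \<Rightarrow> real) set" assume U: "open U" "U \<noteq> {}"
    then obtain y where y: "y \<in> U" by blast
    obtain N e where N: "e > 0" "near {..<N} e y \<subseteq> U" by (rule open_contains_near[OF U(1) y])
    \<comment> \<open>Either \<open>y\<close> or this perturbation differs from \<open>r\<close> at
      \<open>a\<close>.\<close>
    have "y(a := y a + e / 2) \<in> U"
      using N(1) by (intro subsetD[OF N(2)]) (auto simp: near_def)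
    moreover have "y a \<noteq> r \<or> (y(a := y a + e / 2)) a \<noteq> r" using N(1) by auto
    ultimately show "U \<inter> {x. x a \<noteq> r} \<noteq> {}" using y by blast
  qed
  then have "meager_in euclidean (\<Union>r\<in>R. - {x :: nat \<Rightarrow> real. x a \<noteq> r})"
    by (intro meager_UN[OF assms] nowhere_dense_imp_meager)
  then show ?thesis by (rule meager_subset) auto
qed

theorem theorem1p2:
  fixes n :: nat and P Q :: "(nat \<Rightarrow> nat) set"
  assumes "polish_perm_group P" and "polish_perm_group Q"
    and "alg_dim Q \<le> enat n"
    and "locally_finite_pg P" and "n_free (Suc n) P"
  shows "generically_ergodic (euclidean :: (nat \<Rightarrow> real) topology) (bernoulli_eq P)
           (top_of_set inj_seqs) (bernoulli_eq_inj Q)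
         \<and> \<not> borel_reducible (bernoulli_eq P) inj_seqs (bernoulli_eq_inj Q)"
proof
  show erg: "generically_ergodic (euclidean :: (nat \<Rightarrow> real) topology) (bernoulli_eq P)
    (top_of_set inj_seqs) (bernoulli_eq_inj Q)"
    using assms by (rule generically_ergodic_bernoulli)
  show "\<not> borel_reducible (bernoulli_eq P) inj_seqs (bernoulli_eq_inj Q)"
  proof
    assume "borel_reducible (bernoulli_eq P) inj_seqs (bernoulli_eq_inj Q)"
    then obtain f where f: "f \<in> borel_measurable borel" "\<And>x. f x \<in> inj_seqs"
      "\<And>x x'. (x, x') \<in> bernoulli_eq P \<longleftrightarrow> (f x, f x') \<in> bernoulli_eq_inj Q"
      unfolding borel_reducible_def by blast
    have "baire_measurable euclidean (top_of_set inj_seqs) f"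
      using f(1,2) by (rule borel_imp_baire_measurable)
    then obtain C y where C: "comeager_in euclidean C" "\<And>x. x \<in> C \<Longrightarrow> (f x, y) \<in> bernoulli_eq_inj Q"
      using erg f(3) unfolding generically_ergodic_def by metis
    have C_meager: "meager_in euclidean (- C)"
      using C(1) by (simp add: comeager_in_def Compl_eq_Diff_UNIV)
    then have "C \<noteq> {}" using open_not_meager[of "UNIV :: (nat \<Rightarrow> real) set"] by auto
    then obtain z where z: "z \<in> C" by blast
    \<comment> \<open>A reduction puts \<open>C\<close> into the single \<open>P\<close>-orbit of
      \<open>z\<close>, whose members only take values from the countable range of \<open>z\<close>;
      coordinate 0 alone then makes \<open>C\<close> meager.\<close>
    have "C \<subseteq> {x. x 0 \<in> range z}"
    proof
      fix x assume x: "x \<in> C"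
      obtain q where q: "q \<in> Q" "y = bshift q (f z)"
        using C(2)[OF z] unfolding bernoulli_eq_inj_def bernoulli_eq_def by blast
      obtain r where r: "r \<in> Q" "y = bshift r (f x)"
        using C(2)[OF x] unfolding bernoulli_eq_inj_def bernoulli_eq_def by blast
      have "f z = bshift (inv q) (bshift r (f x))"
        using bshift_cancel(1)[OF pgroup(1)[OF assms(2) q(1)]] q(2) r(2) by metis
      also have "\<dots> = bshift (inv q \<circ> r) (f x)"
        using pgroup[OF assms(2)] q(1) r(1) by (simp add: bshift_comp)
      finally have "(f x, f z) \<in> bernoulli_eq_inj Q"
        unfolding bernoulli_eq_inj_def bernoulli_eq_def
        using f(2) pgroup(3,4)[OF assms(2)] q(1) r(1) by blast
      then obtain g where g: "g \<in> P" "z = bshift g x"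
        using f(3) unfolding bernoulli_eq_def by blast
      have "x 0 = z (g 0)"
        using pgroup(1)[OF assms(1) g(1)] unfolding g(2) bshift_def by (simp add: bij_is_inj)
      then show "x \<in> {x. x 0 \<in> range z}" by simp
    qed
    then have "meager_in euclidean C" by (rule meager_subset[OF meager_coordinate, rotated]) simp
    from meager_Un[OF this C_meager] show False
      using open_not_meager[of "UNIV :: (nat \<Rightarrow> real) set"] by simp
  qed
qed

end
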